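(* Let $G$ be a group, let $\Gamma$ be a connected, locally finite, quasi-transitive $G$-graph, and let $\mathcal{H}$ be a thin, $G$-invariant peripheral system of $\Gamma$. Suppose that the cycle space $\mathcal{C}(\widehat{\Gamma}_{\mathcal{H}})$ of the cone-off of $\Gamma$ over $\mathcal{H}$ is topologically $G$-finitely generated. Then $\Gamma$ is accessible relative to $\mathcal{H}$.
   Context: Graphs are simple and undirected. A $G$-graph is a graph with an action of the group $G$ by automorphisms; it is quasi-transitive if there are finitely many $G$-orbits of vertices. A peripheral system is a collection $\mathcal{H}$ of subsets of $V(\Gamma)$. It is $G$-invariant if $gH\in\mathcal{H}$ for all $g\in G$, $H\in\mathcal{H}$, and thin if every vertex lies in at most finitely many $H\in\mathcal{H}$. Cone-off: $\widehat{\Gamma}_{\mathcal{H}}$ is obtained from $\Gamma$ by adding, for every $H\in\mathcal{H}$, a new vertex $v_H$ joined by an edge to every $u\in H$. When $\mathcal H$ is $G$-invariant, $\widehat{\Gamma}_{\mathcal{H}}$ is a $G$-graph. Cycle space: for a graph $\Delta$, $\mathbb{Z}_2^{E(\Delta)}=\prod_{E(\Delta)}\mathbb{Z}_2$ carries the product topology, and $\mathcal{C}(\Delta)\le \mathbb{Z}_2^{E(\Delta)}$ is the subgroup generated by (indicator functions of edge sets of) simple finite cycles. A subset $S\subset\mathcal{C}(\Delta)$ is a topological generating set if $\mathcal{C}(\Delta)\subset\overline{\langle S\rangle}$ (closure in $\mathbb{Z}_2^{E(\Delta)}$ of the subgroup generated by $S$). If $\Delta$ is a $G$-graph, $\mathcal{C}(\Delta)$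 is topologically $G$-finitely generated if there is a $G$-invariant topological generating set $S\subset \mathcal{C}(\Delta)$ consisting of finitely many $G$-orbits. Relative accessibility: for $b\subset V(\Gamma)$ write $b^*=V(\Gamma)\setminus b$, and let $\delta b$ be the set of edges with one endpoint in $b$ and the other in $b^*$. A cut is a set $b$ with $\delta b$ finite. A cut $b$ is $\mathcal{H}$-elliptic if for every $H\in\mathcal{H}$ either $b\cap H$ or $b^*\cap H$ is finite. $\Lambda(b)$ is the set of ends of $\Gamma$ in the closure of $b$ in the Freudenthal (end) compactification; $b$ separates two ends if one lies in $\Lambda(b)$ and the other in $\Lambda(b^* )$. $\Gamma$ is accessible relative to $\mathcal{H}$ if there exists $k\ge1$ such that for every pair of distinct ends $\omega_1,\omega_2$, if some $\mathcal{H}$-elliptic cut separates them, then some $\mathcal{H}$-elliptic cut $b'$ with $|\delta b'|\le k$ separates them. *)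

theory Defs
  imports
    "HOL-Analysis.Analysis"
    "HOL-Algebra.Group_Action"
    "HOL-Algebra.Product_Groups"
begin

section \<open>Simple graphs and actions on them\<close>

text \<open>Graphs may be infinite; an edge is the two-element set of its endpoints.\<close>

record 'v ugraph =
  verts :: "'v set"
  edges :: "'v set set"

definition simple_graph :: "'v ugraph \<Rightarrow> bool" where
  "simple_graph \<Gamma> \<longleftrightarrow> (\<forall>e \<in> edges \<Gamma>. e \<subseteq> verts \<Gamma> \<and> card e = 2)"

definition connection :: "'v ugraph \<Rightarrow> 'v rel" where
  "connection \<Gamma> =
     {(u, v). u \<in> verts \<Gamma> \<and> v \<in> verts \<Gamma> \<and> (u, v) \<in> {(x, y). {x, y} \<in> edges \<Gamma>}\<^sup>*}"

definition connected_graph :: "'v ugraph \<Rightarrow> bool" where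
  "connected_graph \<Gamma> \<longleftrightarrow> (\<forall>u \<in> verts \<Gamma>. \<forall>v \<in> verts \<Gamma>. (u, v) \<in> connection \<Gamma>)"

definition components_graph :: "'v ugraph \<Rightarrow> 'v set set" where
  "components_graph \<Gamma> = verts \<Gamma> // connection \<Gamma>"

definition delete_verts :: "'v ugraph \<Rightarrow> 'v set \<Rightarrow> 'v ugraph" where
  "delete_verts \<Gamma> K = \<lparr>verts = verts \<Gamma> - K, edges = {e \<in> edges \<Gamma>. e \<inter> K = {}}\<rparr>"

definition locally_finite_graph :: "'v ugraph \<Rightarrow> bool" where
  "locally_finite_graph \<Gamma> \<longleftrightarrow> (\<forall>v \<in> verts \<Gamma>. finite {e \<in> edges \<Gamma>. v \<in> e})"

definition G_graph :: "('g, 'm) monoid_scheme \<Rightarrow> 'v ugraph \<Rightarrow> ('g \<Rightarrow> 'v \<Rightarrow> 'v) \<Rightarrow> bool" where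
  "G_graph G \<Gamma> \<phi> \<longleftrightarrow>
     simple_graph \<Gamma> \<and> group_action G (verts \<Gamma>) \<phi> \<and>
     (\<forall>g \<in> carrier G. \<forall>u \<in> verts \<Gamma>. \<forall>v \<in> verts \<Gamma>.
        {\<phi> g u, \<phi> g v} \<in> edges \<Gamma> \<longleftrightarrow> {u, v} \<in> edges \<Gamma>)"

definition quasi_transitive ::
    "('g, 'm) monoid_scheme \<Rightarrow> 'v ugraph \<Rightarrow> ('g \<Rightarrow> 'v \<Rightarrow> 'v) \<Rightarrow> bool" where
  "quasi_transitive G \<Gamma> \<phi> \<longleftrightarrow> finite (orbits G (verts \<Gamma>) \<phi>)"

section \<open>Peripheral systems and cone-offs\<close>

definition peripheral_system :: "'v ugraph \<Rightarrow> 'v set set \<Rightarrow> bool" where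
  "peripheral_system \<Gamma> \<H> \<longleftrightarrow> (\<forall>H \<in> \<H>. H \<subseteq> verts \<Gamma>)"

definition invariant_system ::
    "('g, 'm) monoid_scheme \<Rightarrow> ('g \<Rightarrow> 'v \<Rightarrow> 'v) \<Rightarrow> 'v set set \<Rightarrow> bool" where
  "invariant_system G \<phi> \<H> \<longleftrightarrow> (\<forall>g \<in> carrier G. \<forall>H \<in> \<H>. \<phi> g ` H \<in> \<H>)"

definition thin :: "'v ugraph \<Rightarrow> 'v set set \<Rightarrow> bool" where
  "thin \<Gamma> \<H> \<longleftrightarrow> (\<forall>v \<in> verts \<Gamma>. finite {H \<in> \<H>. v \<in> H})"

text \<open>The cone vertex over \<open>H \<in> \<H>\<close> is \<open>Inr H\<close>.\<close>

definition cone_off :: "'v ugraph \<Rightarrow> 'v set set \<Rightarrow> ('v + 'v set) ugraph" where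
  "cone_off \<Gamma> \<H> =
     \<lparr>verts = verts \<Gamma> <+> \<H>,
      edges = {Inl ` e | e. e \<in> edges \<Gamma>} \<union> {{Inl u, Inr H} | u H. H \<in> \<H> \<and> u \<in> H}\<rparr>"

text \<open>
  The induced action \<open>g v\<^sub>H = v\<^bsub>gH\<^esub>\<close>, restricted to the vertex set because the bijections
  in \<^const>\<open>BijGroup\<close> are extensional.
\<close>

definition cone_action ::
    "'v ugraph \<Rightarrow> 'v set set \<Rightarrow> ('g \<Rightarrow> 'v \<Rightarrow> 'v) \<Rightarrow> 'g \<Rightarrow> 'v + 'v set \<Rightarrow> 'v + 'v set" where
  "cone_action \<Gamma> \<H> \<phi> g = (\<lambda>x \<in> verts \<Gamma> <+> \<H>. map_sum (\<phi> g) (\<lambda>H. \<phi> g ` H) x)"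

section \<open>Cycle spaces\<close>

definition edge_group :: "'v ugraph \<Rightarrow> ('v set \<Rightarrow> int) monoid" where
  "edge_group \<Delta> = product_group (edges \<Delta>) (\<lambda>_. integer_mod_group 2)"

definition edge_topology :: "'v ugraph \<Rightarrow> ('v set \<Rightarrow> int) topology" where
  "edge_topology \<Delta> =
     product_topology (\<lambda>_. discrete_topology (carrier (integer_mod_group 2))) (edges \<Delta>)"

definition edge_indicator :: "'v ugraph \<Rightarrow> 'v set set \<Rightarrow> 'v set \<Rightarrow> int" where
  "edge_indicator \<Delta> F = (\<lambda>e \<in> edges \<Delta>. if e \<in> F then 1 else 0)"

text \<open>A simple cycle is given by the list of its vertices in cyclic order.\<close>

definition cycle_edges :: "'v list \<Rightarrow> 'v set set" where
  "cycle_edges vs = {{vs ! i, vs ! (Suc i mod length vs)} | i. i < length vs}"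

definition simple_cycle :: "'v ugraph \<Rightarrow> 'v list \<Rightarrow> bool" where
  "simple_cycle \<Delta> vs \<longleftrightarrow> 3 \<le> length vs \<and> distinct vs \<and> cycle_edges vs \<subseteq> edges \<Delta>"

definition cycle_space :: "'v ugraph \<Rightarrow> ('v set \<Rightarrow> int) set" where
  "cycle_space \<Delta> =
     generate (edge_group \<Delta>) {edge_indicator \<Delta> (cycle_edges vs) | vs. simple_cycle \<Delta> vs}"

definition topological_generating_set :: "'v ugraph \<Rightarrow> ('v set \<Rightarrow> int) set \<Rightarrow> bool" where
  "topological_generating_set \<Delta> S \<longleftrightarrow>
     S \<subseteq> cycle_space \<Delta> \<and>
     cycle_space \<Delta> \<subseteq> edge_topology \<Delta> closure_of (generate (edge_group \<Delta>) S)"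

text \<open>
  \<open>G\<close> permutes the coordinates: \<open>(g f)(e) = f(g\<inverse> e)\<close>, so that \<open>g\<close> carries the indicator
  function of \<open>F\<close> to that of \<open>gF\<close>.
\<close>

definition edge_action ::
    "('g, 'm) monoid_scheme \<Rightarrow> 'v ugraph \<Rightarrow> ('g \<Rightarrow> 'v \<Rightarrow> 'v)
      \<Rightarrow> 'g \<Rightarrow> ('v set \<Rightarrow> int) \<Rightarrow> ('v set \<Rightarrow> int)" where
  "edge_action G \<Delta> \<psi> g =
     (\<lambda>f \<in> carrier (edge_group \<Delta>). \<lambda>e \<in> edges \<Delta>. f (\<psi> (inv\<^bsub>G\<^esub> g) ` e))"

definition topologically_finitely_generated ::
    "('g, 'm) monoid_scheme \<Rightarrow> 'v ugraph \<Rightarrow> ('g \<Rightarrow> 'v \<Rightarrow> 'v) \<Rightarrow> bool" where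
  "topologically_finitely_generated G \<Delta> \<psi> \<longleftrightarrow>
     (\<exists>S. topological_generating_set \<Delta> S \<and>
          (\<forall>g \<in> carrier G. \<forall>f \<in> S. edge_action G \<Delta> \<psi> g f \<in> S) \<and>
          finite (orbits G S (edge_action G \<Delta> \<psi>)))"

section \<open>Ends and the Freudenthal compactification\<close>

text \<open>
  The space of ends is the inverse limit, over the finite vertex sets \<open>K\<close>, of the sets of
  components of \<open>\<Gamma> - K\<close>.  The components are nonempty, so compatibility forces them to be
  infinite.
\<close>

definition ends :: "'v ugraph \<Rightarrow> ('v set \<Rightarrow> 'v set) set" where
  "ends \<Gamma> =
     {\<omega> \<in> (\<Pi>\<^sub>E K \<in> {K. finite K \<and> K \<subseteq> verts \<Gamma>}. components_graph (delete_verts \<Gamma> K)).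
        \<forall>K K'. finite K' \<and> K' \<subseteq> verts \<Gamma> \<and> K \<subseteq> K' \<longrightarrow> \<omega> K' \<subseteq> \<omega> K}"

text \<open>
  The compactification is taken on vertices and ends, the interior points of edges being left
  out; this does not affect which ends are limits of a set of vertices.  Vertices are isolated,
  and a component \<open>C\<close> of \<open>\<Gamma> - K\<close> yields the open set consisting of \<open>C\<close> and of the ends that
  live in \<open>C\<close>.
\<close>

definition end_compactification :: "'v ugraph \<Rightarrow> ('v + ('v set \<Rightarrow> 'v set)) topology" where
  "end_compactification \<Gamma> =
     topology_generated_by
       ({{Inl v} | v. v \<in> verts \<Gamma>} \<union>
        {C <+> {\<omega> \<in> ends \<Gamma>. \<omega> K = C} | K C.
           finite K \<and> K \<subseteq> verts \<Gamma> \<and> C \<in> components_graph (delete_verts \<Gamma> K)})"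

definition limit_ends :: "'v ugraph \<Rightarrow> 'v set \<Rightarrow> ('v set \<Rightarrow> 'v set) set" where
  "limit_ends \<Gamma> b = {\<omega> \<in> ends \<Gamma>. Inr \<omega> \<in> end_compactification \<Gamma> closure_of (Inl ` b)}"

section \<open>Relative accessibility\<close>

definition coboundary :: "'v ugraph \<Rightarrow> 'v set \<Rightarrow> 'v set set" where
  "coboundary \<Gamma> b = {e \<in> edges \<Gamma>. \<exists>u \<in> b. \<exists>v \<in> verts \<Gamma> - b. e = {u, v}}"

definition cut :: "'v ugraph \<Rightarrow> 'v set \<Rightarrow> bool" where
  "cut \<Gamma> b \<longleftrightarrow> b \<subseteq> verts \<Gamma> \<and> finite (coboundary \<Gamma> b)"

definition elliptic_cut :: "'v ugraph \<Rightarrow> 'v set set \<Rightarrow> 'v set \<Rightarrow> bool" where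
  "elliptic_cut \<Gamma> \<H> b \<longleftrightarrow>
     cut \<Gamma> b \<and> (\<forall>H \<in> \<H>. finite (b \<inter> H) \<or> finite ((verts \<Gamma> - b) \<inter> H))"

definition separates ::
    "'v ugraph \<Rightarrow> 'v set \<Rightarrow> ('v set \<Rightarrow> 'v set) \<Rightarrow> ('v set \<Rightarrow> 'v set) \<Rightarrow> bool" where
  "separates \<Gamma> b \<omega>\<^sub>1 \<omega>\<^sub>2 \<longleftrightarrow>
     \<omega>\<^sub>1 \<in> limit_ends \<Gamma> b \<and> \<omega>\<^sub>2 \<in> limit_ends \<Gamma> (verts \<Gamma> - b) \<or>
     \<omega>\<^sub>2 \<in> limit_ends \<Gamma> b \<and> \<omega>\<^sub>1 \<in> limit_ends \<Gamma> (verts \<Gamma> - b)"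

definition accessible_relative :: "'v ugraph \<Rightarrow> 'v set set \<Rightarrow> bool" where
  "accessible_relative \<Gamma> \<H> \<longleftrightarrow>
     (\<exists>k::nat. 1 \<le> k \<and>
        (\<forall>\<omega>\<^sub>1 \<in> ends \<Gamma>. \<forall>\<omega>\<^sub>2 \<in> ends \<Gamma>.
           \<omega>\<^sub>1 \<noteq> \<omega>\<^sub>2 \<and> (\<exists>b. elliptic_cut \<Gamma> \<H> b \<and> separates \<Gamma> b \<omega>\<^sub>1 \<omega>\<^sub>2) \<longrightarrow>
           (\<exists>b'. elliptic_cut \<Gamma> \<H> b' \<and> card (coboundary \<Gamma> b') \<le> k \<and> separates \<Gamma> b' \<omega>\<^sub>1 \<omega>\<^sub>2)))"

end

theory Submission
  imports Defs
begin

text \<open>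
  An elliptic cut of \<open>\<Gamma>\<close> extends to a finite cut of the cone-off, since only finitely many peripheral
  sets can be split by it, and a finite cut of the cone-off restricts to an elliptic cut of \<open>\<Gamma>\<close>. Ends
  become Boolean homomorphisms on the finite cuts of the cone-off, so it suffices to bound the minimal
  sizes of finite cuts that separate two such homomorphisms. The supports \<open>Z\<close> of the generators are
  finite edge sets, finitely many up to translation, and a finite edge set is a coboundary iff it
  meets every \<open>Z\<close> evenly, because pairing with a finite edge set is continuous.

  Among the minimal cuts separating a given pair, those crossing the fewest minimal cuts of bounded
  size are nested with each other and with their translates, for all pairs simultaneously. Let \<open>c\<close> be
  such a cut with at least two boundary edges. If for every \<open>Z\<close> meeting \<open>\<delta>c\<close> there were a larger cut of
  the family with the same trace on the vertices of \<open>Z\<close>, then an inclusion-minimal larger one would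
  have all of \<open>\<delta>c\<close> in its boundary, which is impossible for bonds. Hence \<open>c\<close> is maximal with its trace on
  some \<open>Z\<close>, and by nestedness it is determined by \<open>Z\<close> and the trace. So up to translation the number
  of such cuts is bounded independently of their size.
\<close>

section \<open>Finite cuts and their homomorphisms\<close>

text \<open>The cone-off need not be locally finite: a cone vertex may have infinite degree, so
  finiteness cannot come from degrees. It comes from the generators: every edge has an endpoint in
  \<Gamma>, and the ground vertices of a generator have uniformly bounded diameter measured in
  \<Gamma>. Hence each edge lies in finitely many supports, and a finite cut splits finitely many of
  them. Crossing numbers are known to be finite only when the cuts counted have size at most some
  \<open>K\<close>, and the family of optimal cuts depends on \<open>K\<close>. The count of traces
  therefore does not bound sizes directly. It bounds the number of different sizes that occur, by a
  constant free of \<open>K\<close>; if infinitely many sizes occurred, a large \<open>K\<close>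
  would exhibit too many of them. The final bound is thus obtained by contradiction. Cuts with a
  single boundary edge stay outside the trace argument, since by parity no generator contains a
  bridge. They contribute only the size 1.\<close>

lemma coboundary_iff:
  assumes "simple_graph \<Delta>" "b \<subseteq> verts \<Delta>"
  shows "e \<in> coboundary \<Delta> b \<longleftrightarrow> e \<in> edges \<Delta> \<and> e \<inter> b \<noteq> {} \<and> e - b \<noteq> {}"
proof
  assume "e \<in> coboundary \<Delta> b"
  then show "e \<in> edges \<Delta> \<and> e \<inter> b \<noteq> {} \<and> e - b \<noteq> {}"
    by (auto simp: coboundary_def)
next
  assume e: "e \<in> edges \<Delta> \<and> e \<inter> b \<noteq> {} \<and> e - b \<noteq> {}"
  then obtain x y where xy: "x \<in> e" "x \<in> b" "y \<in> e" "y \<notin> b" by auto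
  have "card e = 2" "e \<subseteq> verts \<Delta>" using assms(1) e by (auto simp: simple_graph_def)
  then have "e = {x, y}" using xy by (metis card_2_iff insert_commute insert_iff singletonD)
  then show "e \<in> coboundary \<Delta> b"
    using xy e \<open>e \<subseteq> verts \<Delta>\<close> by (auto simp: coboundary_def)
qed

lemma coboundary_pair:
  assumes "simple_graph \<Delta>" "b \<subseteq> verts \<Delta>" "{x, y} \<in> edges \<Delta>"
  shows "{x, y} \<in> coboundary \<Delta> b \<longleftrightarrow> (x \<in> b \<longleftrightarrow> y \<notin> b)"
  using assms(3) by (auto simp: coboundary_iff[OF assms(1,2)])

lemma simple_graph_edgeE:
  assumes "simple_graph \<Delta>" "e \<in> edges \<Delta>"
  obtains x y where "e = {x, y}" "x \<noteq> y" "x \<in> verts \<Delta>" "y \<in> verts \<Delta>"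
  using assms unfolding simple_graph_def by (metis card_2_iff insert_subset)

lemma coboundary_subset_edges: "coboundary \<Delta> b \<subseteq> edges \<Delta>"
  by (auto simp: coboundary_def)

lemma coboundary_compl:
  assumes "b \<subseteq> verts \<Delta>"
  shows "coboundary \<Delta> (verts \<Delta> - b) = coboundary \<Delta> b"
  unfolding coboundary_def double_diff[OF assms subset_refl] by (auto simp: insert_commute)

text \<open>Together the two inclusions say that each edge is counted in the two corners at most as
  often as in \<open>a\<close> and \<open>b\<close>: submodularity of the cut size, stated for edge
  sets.\<close>

lemma coboundary_Int_Un:
  assumes "simple_graph \<Delta>" "a \<subseteq> verts \<Delta>" "b \<subseteq> verts \<Delta>"
  shows "coboundary \<Delta> (a \<inter> b) \<union> coboundary \<Delta> (a \<union> b) \<subseteq> coboundary \<Delta> a \<union> coboundary \<Delta> b"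
    and "coboundary \<Delta> (a \<inter> b) \<inter> coboundary \<Delta> (a \<union> b) \<subseteq> coboundary \<Delta> a \<inter> coboundary \<Delta> b"
proof -
  have sub: "a \<inter> b \<subseteq> verts \<Delta>" "a \<union> b \<subseteq> verts \<Delta>" using assms by auto
  note iff = coboundary_iff[OF assms(1) sub(1)] coboundary_iff[OF assms(1) sub(2)]
    coboundary_iff[OF assms(1,2)] coboundary_iff[OF assms(1,3)]
  show "coboundary \<Delta> (a \<inter> b) \<union> coboundary \<Delta> (a \<union> b) \<subseteq> coboundary \<Delta> a \<union> coboundary \<Delta> b"
    unfolding subset_iff Un_iff iff by blast
  show "coboundary \<Delta> (a \<inter> b) \<inter> coboundary \<Delta> (a \<union> b) \<subseteq> coboundary \<Delta> a \<inter> coboundary \<Delta> b"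
    unfolding subset_iff Int_iff iff by blast
qed

lemma coboundary_sym_diff:
  assumes "simple_graph \<Delta>" "a \<subseteq> verts \<Delta>" "b \<subseteq> verts \<Delta>"
  shows "coboundary \<Delta> (sym_diff a b) = sym_diff (coboundary \<Delta> a) (coboundary \<Delta> b)"
proof -
  have sub: "sym_diff a b \<subseteq> verts \<Delta>" using assms by auto
  have "e \<in> coboundary \<Delta> (sym_diff a b) \<longleftrightarrow> e \<in> sym_diff (coboundary \<Delta> a) (coboundary \<Delta> b)"
    if e: "e \<in> edges \<Delta>" for e
  proof -
    obtain x y where xy: "e = {x, y}" using simple_graph_edgeE[OF assms(1) e] by metis
    show ?thesis
      using e coboundary_pair[OF assms(1) sub, of x y]
      unfolding xy by (auto simp: coboundary_pair[OF assms(1)] assms(2,3))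
  qed
  then show ?thesis using coboundary_subset_edges[of \<Delta>] by blast
qed

lemma cut_compl: "cut \<Delta> a \<Longrightarrow> cut \<Delta> (verts \<Delta> - a)"
  by (simp add: cut_def coboundary_compl)

lemma cut_Int_Un:
  assumes "simple_graph \<Delta>" "cut \<Delta> a" "cut \<Delta> b"
  shows "cut \<Delta> (a \<inter> b)" "cut \<Delta> (a \<union> b)"
  using assms coboundary_Int_Un(1)[of \<Delta> a b]
  by (auto simp: cut_def intro: finite_subset[of _ "coboundary \<Delta> a \<union> coboundary \<Delta> b"])

lemma card_coboundary_submodular:
  assumes "simple_graph \<Delta>" "cut \<Delta> a" "cut \<Delta> b"
  shows "card (coboundary \<Delta> (a \<inter> b)) + card (coboundary \<Delta> (a \<union> b))
    \<le> card (coboundary \<Delta> a) + card (coboundary \<Delta> b)"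
proof -
  let ?A = "coboundary \<Delta> a" and ?B = "coboundary \<Delta> b"
    and ?C = "coboundary \<Delta> (a \<inter> b)" and ?D = "coboundary \<Delta> (a \<union> b)"
  have fin: "finite ?A" "finite ?B" "finite ?C" "finite ?D"
    using assms cut_Int_Un[OF assms] by (auto simp: cut_def)
  have "card ?C + card ?D = card (?C \<union> ?D) + card (?C \<inter> ?D)"
    using fin by (intro card_Un_Int)
  also have "\<dots> \<le> card (?A \<union> ?B) + card (?A \<inter> ?B)"
    using coboundary_Int_Un[of \<Delta> a b] assms fin
    by (intro add_mono card_mono) (auto simp: cut_def)
  also have "\<dots> = card ?A + card ?B" using fin by (intro card_Un_Int[symmetric])
  finally show ?thesis .
qed

section \<open>Crossing cuts, homomorphisms on cuts, and minimal separating cuts\<close>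

definition crossing :: "'v ugraph \<Rightarrow> 'v set \<Rightarrow> 'v set \<Rightarrow> bool" where
  "crossing \<Delta> a b \<longleftrightarrow>
     a \<inter> b \<noteq> {} \<and> a - b \<noteq> {} \<and> b - a \<noteq> {} \<and> verts \<Delta> - (a \<union> b) \<noteq> {}"

text \<open>These are the points of the Stone space of the Boolean algebra of finite cuts. Values on
  sets that are not cuts are left free.\<close>

definition cut_hom :: "'v ugraph \<Rightarrow> ('v set \<Rightarrow> bool) \<Rightarrow> bool" where
  "cut_hom \<Delta> \<omega> \<longleftrightarrow>
     (\<forall>a b. cut \<Delta> a \<longrightarrow> cut \<Delta> b \<longrightarrow> \<omega> (a \<inter> b) = (\<omega> a \<and> \<omega> b)) \<and>
     (\<forall>a. cut \<Delta> a \<longrightarrow> \<omega> (verts \<Delta> - a) = (\<not> \<omega> a))"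

lemma cut_hom_Int: "cut_hom \<Delta> \<omega> \<Longrightarrow> cut \<Delta> a \<Longrightarrow> cut \<Delta> b \<Longrightarrow> \<omega> (a \<inter> b) = (\<omega> a \<and> \<omega> b)"
  and cut_hom_compl: "cut_hom \<Delta> \<omega> \<Longrightarrow> cut \<Delta> a \<Longrightarrow> \<omega> (verts \<Delta> - a) = (\<not> \<omega> a)"
  by (auto simp: cut_hom_def)

lemma cut_hom_Un:
  assumes "simple_graph \<Delta>" "cut_hom \<Delta> \<omega>" "cut \<Delta> a" "cut \<Delta> b"
  shows "\<omega> (a \<union> b) = (\<omega> a \<or> \<omega> b)"
proof -
  have "a \<union> b = verts \<Delta> - ((verts \<Delta> - a) \<inter> (verts \<Delta> - b))"
    using assms by (auto simp: cut_def)
  then show ?thesis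
    using assms by (simp only: cut_hom_compl cut_hom_Int cut_compl cut_Int_Un de_Morgan_conj not_not)
qed

lemma cut_hom_sym_diff:
  assumes "simple_graph \<Delta>" "cut_hom \<Delta> \<omega>" "cut \<Delta> a" "cut \<Delta> b"
  shows "\<omega> (sym_diff a b) = (\<omega> a \<noteq> \<omega> b)"
proof -
  have "sym_diff a b = (a \<inter> (verts \<Delta> - b)) \<union> (b \<inter> (verts \<Delta> - a))"
    using assms by (auto simp: cut_def)
  then show ?thesis
    using assms by (simp only: cut_hom_Un cut_hom_compl cut_hom_Int cut_compl cut_Int_Un) blast
qed

definition minimal_sep :: "'v ugraph \<Rightarrow> ('v set \<Rightarrow> bool) \<Rightarrow> ('v set \<Rightarrow> bool) \<Rightarrow> 'v set \<Rightarrow> bool" where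
  "minimal_sep \<Delta> \<omega> \<eta> c \<longleftrightarrow>
     cut \<Delta> c \<and> \<omega> c \<noteq> \<eta> c \<and>
     (\<forall>a. cut \<Delta> a \<longrightarrow> \<omega> a \<noteq> \<eta> a \<longrightarrow> card (coboundary \<Delta> c) \<le> card (coboundary \<Delta> a))"

definition minimal_cuts :: "'v ugraph \<Rightarrow> nat \<Rightarrow> 'v set set" where
  "minimal_cuts \<Delta> K =
     {c. card (coboundary \<Delta> c) \<le> K \<and> (\<exists>\<omega> \<eta>. cut_hom \<Delta> \<omega> \<and> cut_hom \<Delta> \<eta> \<and> minimal_sep \<Delta> \<omega> \<eta> c)}"

definition crossing_number :: "'v ugraph \<Rightarrow> nat \<Rightarrow> 'v set \<Rightarrow> nat" where
  "crossing_number \<Delta> K c = card {d \<in> minimal_cuts \<Delta> K. crossing \<Delta> d c}"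

text \<open>The competitors \<open>a\<close> carry no size bound of their own: all minimal
  separators of one pair have the same size.\<close>

definition optimal_sep ::
    "'v ugraph \<Rightarrow> nat \<Rightarrow> ('v set \<Rightarrow> bool) \<Rightarrow> ('v set \<Rightarrow> bool) \<Rightarrow> 'v set \<Rightarrow> bool" where
  "optimal_sep \<Delta> K \<omega> \<eta> c \<longleftrightarrow>
     minimal_sep \<Delta> \<omega> \<eta> c \<and> card (coboundary \<Delta> c) \<le> K \<and>
     (\<forall>a. minimal_sep \<Delta> \<omega> \<eta> a \<longrightarrow> crossing_number \<Delta> K c \<le> crossing_number \<Delta> K a)"

definition optimal_cuts :: "'v ugraph \<Rightarrow> nat \<Rightarrow> 'v set set" where
  "optimal_cuts \<Delta> K = {c. \<exists>\<omega> \<eta>. cut_hom \<Delta> \<omega> \<and> cut_hom \<Delta> \<eta> \<and> optimal_sep \<Delta> K \<omega> \<eta> c}"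

text \<open>In a connected graph these are the finite cuts whose two sides are nonempty and induce
  connected subgraphs. Minimality of the coboundary is the form that parity against generators can
  test.\<close>

definition bond :: "'v ugraph \<Rightarrow> 'v set \<Rightarrow> bool" where
  "bond \<Delta> c \<longleftrightarrow> cut \<Delta> c \<and> coboundary \<Delta> c \<noteq> {} \<and>
     (\<forall>a \<subseteq> verts \<Delta>. coboundary \<Delta> a \<subseteq> coboundary \<Delta> c \<longrightarrow> coboundary \<Delta> a \<noteq> {} \<longrightarrow>
        coboundary \<Delta> a = coboundary \<Delta> c)"

text \<open>The properties of the cone-off on which the counting rests: \<open>R\<close> stands for
  the supports of the generators, \<open>R\<^sub>0\<close> for representatives up to translation,
  \<open>A\<close> for the translations. \<open>R_even\<close> and \<open>R_generates\<close>
  characterise finite coboundaries by parity; \<open>R_locally_finite\<close> and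
  \<open>R_split_finite\<close> take the place of local finiteness of the graph.\<close>

locale generated_cuts =
  fixes \<Delta> :: "'v ugraph" and R R\<^sub>0 :: "'v set set set" and A :: "('v \<Rightarrow> 'v) set"
  assumes simple: "simple_graph \<Delta>"
    and coboundary_empty: "b \<subseteq> verts \<Delta> \<Longrightarrow> coboundary \<Delta> b = {} \<Longrightarrow> b = {} \<or> b = verts \<Delta>"
    and R_edges: "Z \<in> R \<Longrightarrow> Z \<subseteq> edges \<Delta>"
    and R_finite: "Z \<in> R \<Longrightarrow> finite Z"
    and R_even: "Z \<in> R \<Longrightarrow> b \<subseteq> verts \<Delta> \<Longrightarrow> even (card (Z \<inter> coboundary \<Delta> b))"
    and R_generates: "F \<subseteq> edges \<Delta> \<Longrightarrow> finite F \<Longrightarrow> (\<And>Z. Z \<in> R \<Longrightarrow> even (card (Z \<inter> F))) \<Longrightarrow>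
      \<exists>b \<subseteq> verts \<Delta>. coboundary \<Delta> b = F"
    and R_locally_finite: "e \<in> edges \<Delta> \<Longrightarrow> finite {Z \<in> R. e \<in> Z}"
    and R_split_finite: "cut \<Delta> c \<Longrightarrow> finite {Z \<in> R. \<Union>Z \<inter> c \<noteq> {} \<and> \<Union>Z - c \<noteq> {}}"
    and A_bij: "g \<in> A \<Longrightarrow> bij_betw g (verts \<Delta>) (verts \<Delta>)"
    and A_edges: "g \<in> A \<Longrightarrow> e \<subseteq> verts \<Delta> \<Longrightarrow> g ` e \<in> edges \<Delta> \<longleftrightarrow> e \<in> edges \<Delta>"
    and A_inverse: "g \<in> A \<Longrightarrow> \<exists>h \<in> A. \<forall>v \<in> verts \<Delta>. h (g v) = v \<and> g (h v) = v"
    and R_orbits: "Z \<in> R \<Longrightarrow> \<exists>g \<in> A. (`) g ` Z \<in> R\<^sub>0"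
    and R0_finite: "finite R\<^sub>0"
    and R0_R: "R\<^sub>0 \<subseteq> R"
begin

lemma coboundary_inj:
  assumes "a \<subseteq> verts \<Delta>" "b \<subseteq> verts \<Delta>" "coboundary \<Delta> a = coboundary \<Delta> b"
  shows "a = b \<or> a = verts \<Delta> - b"
proof -
  have "coboundary \<Delta> (sym_diff a b) = {}"
    using coboundary_sym_diff[OF simple assms(1,2)] assms(3) by simp
  then have "sym_diff a b = {} \<or> sym_diff a b = verts \<Delta>"
    using coboundary_empty[of "sym_diff a b"] assms by blast
  then show ?thesis using assms by blast
qed

text \<open>If a proper nonempty part of the boundary of \<open>c\<close> were the boundary of some
  \<open>a\<close>, the remaining part would be the boundary of \<open>sym_diff c a\<close>. Both
  cuts are smaller than \<open>c\<close>, so neither separates the pair; as homomorphisms turn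
  symmetric differences into exclusive or, \<open>c\<close> would not separate it either.\<close>

lemma minimal_sep_bond:
  assumes "cut_hom \<Delta> \<omega>" "cut_hom \<Delta> \<eta>" "minimal_sep \<Delta> \<omega> \<eta> c"
  shows "bond \<Delta> c"
proof -
  have c: "cut \<Delta> c" "\<omega> c \<noteq> \<eta> c" and
    min: "\<And>a. cut \<Delta> a \<Longrightarrow> \<omega> a \<noteq> \<eta> a \<Longrightarrow> card (coboundary \<Delta> c) \<le> card (coboundary \<Delta> a)"
    using assms(3) by (auto simp: minimal_sep_def)
  have sub: "c \<subseteq> verts \<Delta>" and fin: "finite (coboundary \<Delta> c)" using c by (auto simp: cut_def)
  have "coboundary \<Delta> c \<noteq> {}"
  proof
    assume "coboundary \<Delta> c = {}"
    then have "c = {} \<or> c = verts \<Delta>" using coboundary_empty sub by blast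
    moreover have "cut \<Delta> {}" by (simp add: cut_def coboundary_def)
    ultimately have "\<omega> c = \<eta> c"
      using cut_hom_Int[OF _ \<open>cut \<Delta> {}\<close> cut_compl[OF \<open>cut \<Delta> {}\<close>]]
        cut_hom_compl[OF _ \<open>cut \<Delta> {}\<close>] assms(1,2) by (metis Diff_empty Int_empty_left)
    then show False using c by simp
  qed
  moreover have "coboundary \<Delta> a = coboundary \<Delta> c"
    if a: "a \<subseteq> verts \<Delta>" "coboundary \<Delta> a \<subseteq> coboundary \<Delta> c" "coboundary \<Delta> a \<noteq> {}" for a
  proof (rule ccontr)
    assume ne: "coboundary \<Delta> a \<noteq> coboundary \<Delta> c"
    let ?d = "sym_diff c a"
    have cuta: "cut \<Delta> a" using a fin by (auto simp: cut_def intro: finite_subset)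
    have eq: "coboundary \<Delta> ?d = coboundary \<Delta> c - coboundary \<Delta> a"
      using coboundary_sym_diff[OF simple sub a(1)] a by auto
    then have cutd: "cut \<Delta> ?d" using fin sub a by (auto simp: cut_def)
    have "card (coboundary \<Delta> ?d) < card (coboundary \<Delta> c)"
      unfolding eq using a fin by (intro psubset_card_mono) auto
    moreover have "card (coboundary \<Delta> a) < card (coboundary \<Delta> c)"
      using a ne fin by (intro psubset_card_mono) auto
    ultimately have "\<omega> ?d = \<eta> ?d" "\<omega> a = \<eta> a" using min[OF cutd] min[OF cuta] by auto
    then have "\<omega> c = \<eta> c"
      using cut_hom_sym_diff[OF simple assms(1) c(1) cuta] cut_hom_sym_diff[OF simple assms(2) c(1) cuta]
      by auto
    then show False using c by simp
  qed
  ultimately show ?thesis using c(1) by (auto simp: bond_def)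
qed

text \<open>Otherwise every generator meets \<open>F\<close> either not at all or in its whole
  intersection with the boundary, hence evenly, and \<open>F\<close> would be a smaller coboundary.
  So the boundary of a bond is connected when edges in a common generator are regarded as
  adjacent.\<close>

lemma bond_linked:
  assumes "bond \<Delta> c" "F \<subseteq> coboundary \<Delta> c" "F \<noteq> {}" "F \<noteq> coboundary \<Delta> c"
  shows "\<exists>Z \<in> R. Z \<inter> F \<noteq> {} \<and> Z \<inter> (coboundary \<Delta> c - F) \<noteq> {}"
proof (rule ccontr)
  assume none: "\<not> ?thesis"
  have c: "c \<subseteq> verts \<Delta>" "finite (coboundary \<Delta> c)" using assms(1) by (auto simp: bond_def cut_def)
  have "even (card (Z \<inter> F))" if Z: "Z \<in> R" for Z
  proof -
    have "Z \<inter> F = {} \<or> Z \<inter> F = Z \<inter> coboundary \<Delta> c" using none Z assms(2) by blast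
    then show ?thesis using R_even[OF Z c(1)] by auto
  qed
  then obtain a where "a \<subseteq> verts \<Delta>" "coboundary \<Delta> a = F"
    using R_generates[of F] assms(2) c coboundary_subset_edges by (meson finite_subset order_trans)
  then show False using assms by (auto simp: bond_def)
qed

text \<open>The ball of radius \<open>n\<close> around \<open>e\<close> in the hypergraph whose
  points are the edges and whose hyperedges are the members of \<open>R\<close>.\<close>

fun edge_nbhd :: "nat \<Rightarrow> 'v set \<Rightarrow> 'v set set" where
  "edge_nbhd 0 e = {e}"
| "edge_nbhd (Suc n) e = edge_nbhd n e \<union> \<Union>{Z \<in> R. Z \<inter> edge_nbhd n e \<noteq> {}}"

lemma edge_nbhd_finite:
  assumes "e \<in> edges \<Delta>"
  shows "edge_nbhd n e \<subseteq> edges \<Delta> \<and> finite (edge_nbhd n e)"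
proof (induction n)
  case (Suc n)
  have "{Z \<in> R. Z \<inter> edge_nbhd n e \<noteq> {}} = (\<Union>f \<in> edge_nbhd n e. {Z \<in> R. f \<in> Z})" by auto
  then have "finite {Z \<in> R. Z \<inter> edge_nbhd n e \<noteq> {}}"
    using Suc R_locally_finite by auto
  then show ?case using Suc R_edges R_finite by auto
qed (use assms in auto)

text \<open>As long as the ball misses part of the boundary, linkedness makes the next ball capture
  at least one more boundary edge. The count starts at 1 with \<open>e\<close> itself, so a boundary
  not exhausted at radius \<open>K\<close> would have more than \<open>K\<close> edges.\<close>

lemma bond_subset_nbhd:
  assumes "bond \<Delta> c" "e \<in> coboundary \<Delta> c" "card (coboundary \<Delta> c) \<le> K"
  shows "coboundary \<Delta> c \<subseteq> edge_nbhd K e"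
proof -
  let ?F = "coboundary \<Delta> c"
  have fin: "finite ?F" using assms(1) by (auto simp: bond_def cut_def)
  have mem: "e \<in> edge_nbhd n e" for n by (induction n) auto
  have "?F \<subseteq> edge_nbhd n e \<or> n < card (?F \<inter> edge_nbhd n e)" for n
  proof (induction n)
    case 0
    then show ?case using assms(2) by simp
  next
    case (Suc n)
    show ?case
    proof (cases "?F \<subseteq> edge_nbhd n e")
      case False
      then have "?F \<inter> edge_nbhd n e \<noteq> ?F" by auto
      then obtain Z where Z: "Z \<in> R" "Z \<inter> (?F \<inter> edge_nbhd n e) \<noteq> {}" "Z \<inter> (?F - ?F \<inter> edge_nbhd n e) \<noteq> {}"
        using bond_linked[OF assms(1), of "?F \<inter> edge_nbhd n e"] assms(2) mem[of n] by blast
      then have "Z \<subseteq> edge_nbhd (Suc n) e" by auto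
      then have "?F \<inter> edge_nbhd n e \<subset> ?F \<inter> edge_nbhd (Suc n) e" using Z by auto
      then have "card (?F \<inter> edge_nbhd n e) < card (?F \<inter> edge_nbhd (Suc n) e)"
        using fin by (intro psubset_card_mono) auto
      then show ?thesis using Suc False by linarith
    qed auto
  qed
  moreover have "card (?F \<inter> edge_nbhd K e) \<le> K" using assms(3) card_mono[OF fin, of "?F \<inter> edge_nbhd K e"] by auto
  ultimately show ?thesis by (metis not_le)
qed

text \<open>The boundaries in question are subsets of one finite ball, and a boundary determines its
  cut up to complement.\<close>

lemma finite_bonds_through_edge:
  assumes "e \<in> edges \<Delta>"
  shows "finite {c. bond \<Delta> c \<and> e \<in> coboundary \<Delta> c \<and> card (coboundary \<Delta> c) \<le> K}" (is "finite ?B")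
proof -
  have "finite (coboundary \<Delta> ` ?B)"
  proof (rule finite_subset)
    show "coboundary \<Delta> ` ?B \<subseteq> Pow (edge_nbhd K e)" using bond_subset_nbhd by blast
    show "finite (Pow (edge_nbhd K e))" using edge_nbhd_finite[OF assms, of K] by simp
  qed
  moreover have "finite {c \<in> ?B. coboundary \<Delta> c = F}" for F
  proof (cases "\<exists>d. d \<subseteq> verts \<Delta> \<and> coboundary \<Delta> d = F")
    case True
    then obtain d where "d \<subseteq> verts \<Delta>" "coboundary \<Delta> d = F" by auto
    then have "{c \<in> ?B. coboundary \<Delta> c = F} \<subseteq> {d, verts \<Delta> - d}"
      using coboundary_inj[of _ d] by (auto simp: bond_def cut_def)
    then show ?thesis by (rule finite_subset) auto
  next
    case False
    then have none: "{c \<in> ?B. coboundary \<Delta> c = F} = {}" unfolding bond_def cut_def by blast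
    show ?thesis unfolding none by simp
  qed
  ultimately have "finite (\<Union>F \<in> coboundary \<Delta> ` ?B. {c \<in> ?B. coboundary \<Delta> c = F})" by (rule finite_UN_I)
  moreover have "?B \<subseteq> (\<Union>F \<in> coboundary \<Delta> ` ?B. {c \<in> ?B. coboundary \<Delta> c = F})"
    by (intro subsetI UN_I[OF imageI]) simp_all
  ultimately show ?thesis by (rule finite_subset[rotated])
qed

end

section \<open>Uncrossing: optimal cuts are pairwise nested\<close>

lemma crossing_compl:
  assumes "a \<subseteq> verts \<Delta>" "b \<subseteq> verts \<Delta>"
  shows "crossing \<Delta> a (verts \<Delta> - b) \<longleftrightarrow> crossing \<Delta> a b"
  using assms unfolding crossing_def by blast

text \<open>The set-theoretic content of submodularity for crossing numbers: a cut \<open>e\<close>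
  crosses the two corners together at most as often as \<open>a\<close> and \<open>b\<close>
  together. The cut \<open>a\<close> itself crosses \<open>b\<close> but neither corner, and this
  makes the inequality strict.\<close>

lemma crossing_corner:
  assumes "a \<subseteq> verts \<Delta>" "b \<subseteq> verts \<Delta>" "e \<subseteq> verts \<Delta>" "crossing \<Delta> a b"
  shows "crossing \<Delta> e (a \<inter> b) \<Longrightarrow> crossing \<Delta> e a \<or> crossing \<Delta> e b"
    and "crossing \<Delta> e (a \<union> b) \<Longrightarrow> crossing \<Delta> e a \<or> crossing \<Delta> e b"
    and "crossing \<Delta> e (a \<inter> b) \<Longrightarrow> crossing \<Delta> e (a \<union> b) \<Longrightarrow> crossing \<Delta> e a \<and> crossing \<Delta> e b"
    and "\<not> crossing \<Delta> a (a \<inter> b)" "\<not> crossing \<Delta> a (a \<union> b)"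
  using assms unfolding crossing_def by blast+

lemma crossing_number_compl:
  assumes "c \<subseteq> verts \<Delta>"
  shows "crossing_number \<Delta> K (verts \<Delta> - c) = crossing_number \<Delta> K c"
proof -
  have "d \<subseteq> verts \<Delta>" if "d \<in> minimal_cuts \<Delta> K" for d
    using that by (auto simp: minimal_cuts_def minimal_sep_def cut_def)
  then have "{d \<in> minimal_cuts \<Delta> K. crossing \<Delta> d (verts \<Delta> - c)} = {d \<in> minimal_cuts \<Delta> K. crossing \<Delta> d c}"
    using crossing_compl[OF _ assms] by blast
  then show ?thesis by (simp add: crossing_number_def)
qed

text \<open>
  The truth values of two pairs of cut homomorphisms on two crossing cuts \<open>c\<close> and \<open>d\<close>:
  \<open>p, p'\<close> and \<open>x, x'\<close> are the values on \<open>c\<close>, \<open>q, q'\<close> and \<open>y, y'\<close> those on \<open>d\<close>.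
\<close>

lemma crossing_values_False:
  assumes "p \<noteq> p'" "y \<noteq> y'"
    and "\<not> (((p \<and> q) \<noteq> (p' \<and> q')) \<and> ((x \<or> y) \<noteq> (x' \<or> y'))) \<and>
      \<not> (((x \<and> y) \<noteq> (x' \<and> y')) \<and> ((p \<or> q) \<noteq> (p' \<or> q'))) \<and>
      (((p \<and> q) \<noteq> (p' \<and> q')) \<and> ((p \<or> q) \<noteq> (p' \<or> q')) \<and> E \<longrightarrow> L) \<and>
      (((x \<and> y) \<noteq> (x' \<and> y')) \<and> ((x \<or> y) \<noteq> (x' \<or> y')) \<and> E \<longrightarrow> M)"
    and "\<not> (((p \<and> \<not> q) \<noteq> (p' \<and> \<not> q')) \<and> ((x \<or> \<not> y) \<noteq> (x' \<or> \<not> y'))) \<and>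
      \<not> (((x \<and> \<not> y) \<noteq> (x' \<and> \<not> y')) \<and> ((p \<or> \<not> q) \<noteq> (p' \<or> \<not> q'))) \<and>
      (((p \<and> \<not> q) \<noteq> (p' \<and> \<not> q')) \<and> ((p \<or> \<not> q) \<noteq> (p' \<or> \<not> q')) \<and> E \<longrightarrow> L) \<and>
      (((x \<and> \<not> y) \<noteq> (x' \<and> \<not> y')) \<and> ((x \<or> \<not> y) \<noteq> (x' \<or> \<not> y')) \<and> E \<longrightarrow> M)"
    and "q \<noteq> q' \<Longrightarrow> x \<noteq> x' \<Longrightarrow> E" "\<not> (L \<and> M)"
  shows False
  using assms by (cases p; cases p'; cases q; cases q'; cases x; cases x'; cases y; cases y') simp_all

lemma optimal_sep_exists:
  assumes "minimal_sep \<Delta> \<omega> \<eta> c" "card (coboundary \<Delta> c) \<le> K"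
  shows "\<exists>d. optimal_sep \<Delta> K \<omega> \<eta> d \<and> card (coboundary \<Delta> d) = card (coboundary \<Delta> c)"
proof -
  obtain d where d: "minimal_sep \<Delta> \<omega> \<eta> d"
    "\<And>a. minimal_sep \<Delta> \<omega> \<eta> a \<Longrightarrow> crossing_number \<Delta> K d \<le> crossing_number \<Delta> K a"
    using ex_has_least_nat[of "minimal_sep \<Delta> \<omega> \<eta>" c "crossing_number \<Delta> K"] assms by blast
  moreover have "card (coboundary \<Delta> d) = card (coboundary \<Delta> c)"
    using d(1) assms(1) by (auto simp: minimal_sep_def intro: le_antisym)
  ultimately show ?thesis using assms(2) by (auto simp: optimal_sep_def)
qed

context generated_cuts
begin

lemma bond_compl: "bond \<Delta> c \<Longrightarrow> bond \<Delta> (verts \<Delta> - c)"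
  by (auto simp: bond_def cut_compl coboundary_compl cut_def)

text \<open>This is connectedness of the side \<open>c\<close>. A boundary edge of
  \<open>c \<inter> d\<close> that is not in the boundary of \<open>c\<close> lies inside
  \<open>c\<close> and crosses \<open>d\<close>; without such edges the bond property would give
  \<open>c \<inter> d\<close> the same boundary as \<open>c\<close>, so it would equal
  \<open>c\<close> or its complement.\<close>

lemma bond_split_edge:
  assumes "bond \<Delta> c" "d \<subseteq> verts \<Delta>" "c \<inter> d \<noteq> {}" "c - d \<noteq> {}"
  shows "\<exists>e \<in> coboundary \<Delta> d. e \<subseteq> c"
proof (rule ccontr)
  assume none: "\<not> ?thesis"
  have c: "c \<subseteq> verts \<Delta>" using assms(1) by (auto simp: bond_def cut_def)
  then have sub: "c \<inter> d \<subseteq> verts \<Delta>" by auto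
  have "coboundary \<Delta> (c \<inter> d) \<subseteq> coboundary \<Delta> c"
  proof
    fix e assume e: "e \<in> coboundary \<Delta> (c \<inter> d)"
    show "e \<in> coboundary \<Delta> c"
    proof (rule ccontr)
      assume "e \<notin> coboundary \<Delta> c"
      then have "e \<in> coboundary \<Delta> d" "e \<subseteq> c"
        using e unfolding coboundary_iff[OF simple c] coboundary_iff[OF simple sub]
          coboundary_iff[OF simple assms(2)] by blast+
      then show False using none by blast
    qed
  qed
  moreover have "coboundary \<Delta> (c \<inter> d) \<noteq> {}"
    using coboundary_empty[OF sub] assms(3,4) c by blast
  ultimately have "coboundary \<Delta> (c \<inter> d) = coboundary \<Delta> c"
    using assms(1) sub by (auto simp: bond_def)
  then show False using coboundary_inj[OF sub c] assms(3,4) by blast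
qed

text \<open>A bond \<open>d\<close> crossing \<open>c\<close> has a boundary edge inside
  \<open>c\<close> and one inside the complement. By linkedness some generator contains a boundary
  edge of \<open>d\<close> inside \<open>c\<close> and another one not inside \<open>c\<close>, so
  it is split by \<open>c\<close>. Only finitely many generators are split, each has finitely many
  edges, and each edge lies in the boundary of finitely many bonds of bounded size.\<close>

lemma finite_crossing_bonds:
  assumes "bond \<Delta> c"
  shows "finite {d. bond \<Delta> d \<and> card (coboundary \<Delta> d) \<le> K \<and> crossing \<Delta> d c}"
proof -
  let ?Zs = "{Z \<in> R. \<Union>Z \<inter> c \<noteq> {} \<and> \<Union>Z - c \<noteq> {}}"
  let ?B = "\<lambda>e. {d. bond \<Delta> d \<and> e \<in> coboundary \<Delta> d \<and> card (coboundary \<Delta> d) \<le> K}"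
  have cutc: "cut \<Delta> c" "c \<subseteq> verts \<Delta>" using assms by (auto simp: bond_def cut_def)
  have "finite (\<Union>Z \<in> ?Zs. \<Union>e \<in> Z. ?B e)"
  proof (intro finite_UN_I)
    show "finite ?Zs" using R_split_finite[OF cutc(1)] .
    show "finite Z" if "Z \<in> ?Zs" for Z using that R_finite by simp
    show "finite (?B e)" if "Z \<in> ?Zs" "e \<in> Z" for Z e
      using that R_edges by (intro finite_bonds_through_edge) blast
  qed
  moreover have "d \<in> (\<Union>Z \<in> ?Zs. \<Union>e \<in> Z. ?B e)"
    if d: "bond \<Delta> d" "card (coboundary \<Delta> d) \<le> K" "crossing \<Delta> d c" for d
  proof -
    have dV: "d \<subseteq> verts \<Delta>" using d(1) by (auto simp: bond_def cut_def)
    let ?F = "{e \<in> coboundary \<Delta> d. e \<subseteq> c}"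
    have 1: "\<exists>e \<in> coboundary \<Delta> d. e \<subseteq> c"
      using d(3) by (intro bond_split_edge[OF assms dV]) (auto simp: crossing_def)
    have "\<exists>e \<in> coboundary \<Delta> d. e \<subseteq> verts \<Delta> - c"
      using d(3) dV by (intro bond_split_edge[OF bond_compl[OF assms] dV]) (auto simp: crossing_def)
    moreover have "e \<noteq> {}" if "e \<in> coboundary \<Delta> d" for e using that by (auto simp: coboundary_def)
    ultimately have 2: "?F \<noteq> coboundary \<Delta> d" by blast
    obtain Z where Z: "Z \<in> R" "Z \<inter> ?F \<noteq> {}" "Z \<inter> (coboundary \<Delta> d - ?F) \<noteq> {}"
      using bond_linked[OF d(1) _ _ 2] 1 by blast
    then obtain e f where ef: "e \<in> Z" "e \<in> coboundary \<Delta> d" "e \<subseteq> c" "f \<in> Z" "\<not> f \<subseteq> c" by blast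
    have "e \<noteq> {}" using ef(2) by (auto simp: coboundary_def)
    then have "Z \<in> ?Zs" using Z(1) ef by blast
    then show ?thesis using ef d by blast
  qed
  ultimately show ?thesis by (elim finite_subset[rotated]) (intro subsetI, simp only: mem_Collect_eq)
qed

lemma minimal_cuts_bond:
  assumes "c \<in> minimal_cuts \<Delta> K"
  shows "bond \<Delta> c" "card (coboundary \<Delta> c) \<le> K"
  using assms minimal_sep_bond by (auto simp: minimal_cuts_def)

text \<open>The strict drop comes from \<open>c\<close> itself: being a minimal cut, it is counted
  among those crossing \<open>d\<close>, but it crosses neither corner.\<close>

lemma crossing_number_submodular:
  assumes "c \<in> minimal_cuts \<Delta> K" "bond \<Delta> d" "crossing \<Delta> c d"
  shows "crossing_number \<Delta> K (c \<inter> d) + crossing_number \<Delta> K (c \<union> d)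
    < crossing_number \<Delta> K c + crossing_number \<Delta> K d"
proof -
  let ?N = "\<lambda>x. {e \<in> minimal_cuts \<Delta> K. crossing \<Delta> e x}"
  have fin: "finite (?N x)" if "bond \<Delta> x" for x
    using minimal_cuts_bond by (intro finite_subset[OF _ finite_crossing_bonds[OF that, of K]]) auto
  have c: "bond \<Delta> c" using minimal_cuts_bond assms(1) by auto
  have V: "x \<subseteq> verts \<Delta>" if "bond \<Delta> x" for x using that by (auto simp: bond_def cut_def)
  have VM: "e \<subseteq> verts \<Delta>" if "e \<in> minimal_cuts \<Delta> K" for e using that minimal_cuts_bond V by auto
  note corner = crossing_corner[OF V[OF c] V[OF assms(2)] VM assms(3)]
  have sub: "?N (c \<inter> d) \<union> ?N (c \<union> d) \<subseteq> (?N c \<union> ?N d) - {c}"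
    "?N (c \<inter> d) \<inter> ?N (c \<union> d) \<subseteq> ?N c \<inter> ?N d"
    using corner by blast+
  have fin': "finite (?N (c \<inter> d))" "finite (?N (c \<union> d))"
    using sub(1) fin[OF c] fin[OF assms(2)] by (auto intro: finite_subset[of _ "?N c \<union> ?N d"])
  have mem: "c \<in> ?N c \<union> ?N d" using assms by auto
  have "card (?N (c \<inter> d)) + card (?N (c \<union> d)) =
    card (?N (c \<inter> d) \<union> ?N (c \<union> d)) + card (?N (c \<inter> d) \<inter> ?N (c \<union> d))"
    using fin' by (intro card_Un_Int)
  also have "\<dots> \<le> card ((?N c \<union> ?N d) - {c}) + card (?N c \<inter> ?N d)"
    using fin[OF c] fin[OF assms(2)] sub by (intro add_mono card_mono) auto
  also have "\<dots> < card (?N c \<union> ?N d) + card (?N c \<inter> ?N d)"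
    using fin[OF c] fin[OF assms(2)] mem by (intro add_less_mono1 card_Diff1_less) auto
  also have "\<dots> = card (?N c) + card (?N d)"
    using fin[OF c] fin[OF assms(2)] by (intro card_Un_Int[symmetric])
  finally show ?thesis unfolding crossing_number_def .
qed

lemma optimal_cuts_minimal: "c \<in> optimal_cuts \<Delta> K \<Longrightarrow> c \<in> minimal_cuts \<Delta> K"
  by (auto simp: optimal_cuts_def optimal_sep_def minimal_cuts_def)

text \<open>Uncrossing for two possibly different pairs: submodularity first forces equality of
  sizes at the corners, and the strict drop of crossing numbers then contradicts optimality.\<close>

lemma optimal_cuts_nested:
  assumes "c \<in> optimal_cuts \<Delta> K" "d \<in> optimal_cuts \<Delta> K"
  shows "\<not> crossing \<Delta> c d"
proof
  assume cross: "crossing \<Delta> c d"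
  obtain \<omega>\<^sub>1 \<omega>\<^sub>2 where P: "cut_hom \<Delta> \<omega>\<^sub>1" "cut_hom \<Delta> \<omega>\<^sub>2" "optimal_sep \<Delta> K \<omega>\<^sub>1 \<omega>\<^sub>2 c"
    using assms(1) by (auto simp: optimal_cuts_def)
  obtain \<eta>\<^sub>1 \<eta>\<^sub>2 where Q: "cut_hom \<Delta> \<eta>\<^sub>1" "cut_hom \<Delta> \<eta>\<^sub>2" "optimal_sep \<Delta> K \<eta>\<^sub>1 \<eta>\<^sub>2 d"
    using assms(2) by (auto simp: optimal_cuts_def)
  let ?s = "\<lambda>b. card (coboundary \<Delta> b)" and ?m = "crossing_number \<Delta> K"
  let ?p = "\<lambda>b. \<omega>\<^sub>1 b \<noteq> \<omega>\<^sub>2 b" and ?q = "\<lambda>b. \<eta>\<^sub>1 b \<noteq> \<eta>\<^sub>2 b"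
  have c: "cut \<Delta> c" "?p c" and d: "cut \<Delta> d" "?q d"
    using P Q by (auto simp: optimal_sep_def minimal_sep_def)
  have V: "c \<subseteq> verts \<Delta>" "d \<subseteq> verts \<Delta>" using c d by (auto simp: cut_def)
  have sp: "?s c \<le> ?s b" if "cut \<Delta> b" "?p b" for b
    using P(3) that by (auto simp: optimal_sep_def minimal_sep_def)
  have sq: "?s d \<le> ?s b" if "cut \<Delta> b" "?q b" for b
    using Q(3) that by (auto simp: optimal_sep_def minimal_sep_def)
  have mp: "?m c \<le> ?m b" if "cut \<Delta> b" "?p b" "?s b = ?s c" for b
    using P(3) that by (auto simp: optimal_sep_def minimal_sep_def)
  have mq: "?m d \<le> ?m b" if "cut \<Delta> b" "?q b" "?s b = ?s d" for b
    using Q(3) that by (auto simp: optimal_sep_def minimal_sep_def)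
  have bd: "bond \<Delta> d" using minimal_cuts_bond optimal_cuts_minimal assms(2) by blast
  \<comment> \<open>With \<open>b\<close> equal to \<open>d\<close> or to its complement,
    \<open>c \<inter> b\<close> and \<open>c \<union> b\<close> run, up to complement, over the two
    pairs of opposite corners. If each of the two pairs of homomorphisms is separated by one corner
    of an opposite pair, minimality and submodularity leave only equality of sizes, and the strict
    drop is contradictory. If one pair of homomorphisms is separated by both corners and
    \<open>c\<close>, \<open>d\<close> have equal size, the same estimate compares the two crossing
    numbers.\<close>
  have *: "\<not> (?p (c \<inter> b) \<and> ?q (c \<union> b)) \<and> \<not> (?q (c \<inter> b) \<and> ?p (c \<union> b)) \<and>
      (?p (c \<inter> b) \<and> ?p (c \<union> b) \<and> ?s c = ?s d \<longrightarrow> ?m c < ?m d) \<and>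
      (?q (c \<inter> b) \<and> ?q (c \<union> b) \<and> ?s c = ?s d \<longrightarrow> ?m d < ?m c)"
    if b: "b = d \<or> b = verts \<Delta> - d" for b
  proof -
    have cutb: "cut \<Delta> b" using b d cut_compl by auto
    have sb: "?s b = ?s d" using b V by (auto simp: coboundary_compl)
    have mb: "?m b = ?m d" using b V by (auto simp: crossing_number_compl)
    have "crossing \<Delta> c b" using b cross crossing_compl[OF V] by auto
    then have m: "?m (c \<inter> b) + ?m (c \<union> b) < ?m c + ?m d"
      using crossing_number_submodular[OF optimal_cuts_minimal[OF assms(1)], of b] bd bond_compl b mb
      by auto
    have s: "?s (c \<inter> b) + ?s (c \<union> b) \<le> ?s c + ?s d"
      using card_coboundary_submodular[OF simple c(1) cutb] sb by simp
    note cuts = cut_Int_Un[OF simple c(1) cutb]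
    note facts = sp[OF cuts(1)] sp[OF cuts(2)] sq[OF cuts(1)] sq[OF cuts(2)]
      mp[OF cuts(1)] mp[OF cuts(2)] mq[OF cuts(1)] mq[OF cuts(2)]
    have "\<not> (?p (c \<inter> b) \<and> ?q (c \<union> b))" using facts(1,4,5,8) m s by force
    moreover have "\<not> (?q (c \<inter> b) \<and> ?p (c \<union> b))" using facts(2,3,6,7) m s by force
    moreover have "?m c < ?m d" if "?p (c \<inter> b) \<and> ?p (c \<union> b) \<and> ?s c = ?s d"
      using that facts(1,2,5,6) m s by force
    moreover have "?m d < ?m c" if "?q (c \<inter> b) \<and> ?q (c \<union> b) \<and> ?s c = ?s d"
      using that facts(3,4,7,8) m s by force
    ultimately show ?thesis by blast
  qed
  have size_eq: "?s c = ?s d" if "?p d" "?q c" using sp[OF d(1) that(1)] sq[OF c(1) that(2)] by simp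
  note corners = *[OF disjI1[OF refl]] *[OF disjI2[OF refl]]
  have ev: "\<zeta> (c \<inter> d) = (\<zeta> c \<and> \<zeta> d)" "\<zeta> (c \<union> d) = (\<zeta> c \<or> \<zeta> d)"
    "\<zeta> (c \<inter> (verts \<Delta> - d)) = (\<zeta> c \<and> \<not> \<zeta> d)" "\<zeta> (c \<union> (verts \<Delta> - d)) = (\<zeta> c \<or> \<not> \<zeta> d)"
    if "cut_hom \<Delta> \<zeta>" for \<zeta>
    using that c(1) d(1) cut_compl[OF d(1)]
    by (simp_all only: cut_hom_Int cut_hom_Un[OF simple] cut_hom_compl)
  have asym: "\<not> (?m c < ?m d \<and> ?m d < ?m c)" by simp
  \<comment> \<open>If the first pair of homomorphisms agrees on \<open>d\<close>, it is separated
    by exactly one corner of each opposite pair; if it also differs on \<open>d\<close>, by both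
    corners of one opposite pair and none of the other. The same holds for the second pair with
    respect to \<open>c\<close>. Either opposite corners separate different pairs, which
    \<open>corners\<close> excludes, or each pair takes both corners of its own opposite pair; then
    the sizes are equal and both strict inequalities between the crossing numbers follow.\<close>
  show False
    by (rule crossing_values_False[OF c(2) d(2)
        corners[unfolded ev[OF P(1)] ev[OF P(2)] ev[OF Q(1)] ev[OF Q(2)]] size_eq asym])
qed

end

section \<open>Translates of optimal cuts\<close>

definition trace_maximal :: "'v ugraph \<Rightarrow> nat \<Rightarrow> 'v set set \<Rightarrow> 'v set \<Rightarrow> bool" where
  "trace_maximal \<Delta> K Z c \<longleftrightarrow>
     Z \<inter> coboundary \<Delta> c \<noteq> {} \<and> (\<forall>s \<in> optimal_cuts \<Delta> K. c \<subset> s \<longrightarrow> s \<inter> \<Union>Z \<noteq> c \<inter> \<Union>Z)"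

context generated_cuts
begin

lemma A_image_inverse:
  assumes "g \<in> A"
  shows "\<exists>h \<in> A. \<forall>b \<subseteq> verts \<Delta>. h ` g ` b = b \<and> g ` h ` b = b"
proof -
  obtain h where h: "h \<in> A" "\<And>v. v \<in> verts \<Delta> \<Longrightarrow> h (g v) = v" "\<And>v. v \<in> verts \<Delta> \<Longrightarrow> g (h v) = v"
    using A_inverse[OF assms] by auto
  have "h ` g ` b = b" "g ` h ` b = b" if "b \<subseteq> verts \<Delta>" for b
    using that by (simp_all add: image_image subset_iff h(2,3) cong: image_cong_simp)
  then show ?thesis using h(1) by (intro bexI[of _ h]) simp_all
qed

lemma A_subset: "g \<in> A \<Longrightarrow> b \<subseteq> verts \<Delta> \<Longrightarrow> g ` b \<subseteq> verts \<Delta>"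
  using A_bij by (auto simp: bij_betw_def)

lemma A_inj: "g \<in> A \<Longrightarrow> inj_on g (verts \<Delta>)"
  using A_bij by (auto simp: bij_betw_def)

lemma A_surj: "g \<in> A \<Longrightarrow> g ` verts \<Delta> = verts \<Delta>"
  using A_bij by (auto simp: bij_betw_def)

lemma edge_subset: "e \<in> edges \<Delta> \<Longrightarrow> e \<subseteq> verts \<Delta>"
  using simple by (auto simp: simple_graph_def)

lemma coboundary_image_subset:
  assumes "g \<in> A" "b \<subseteq> verts \<Delta>"
  shows "(`) g ` coboundary \<Delta> b \<subseteq> coboundary \<Delta> (g ` b)"
proof
  fix f assume "f \<in> (`) g ` coboundary \<Delta> b"
  then obtain e where e: "f = g ` e" "e \<in> edges \<Delta>" "e \<inter> b \<noteq> {}" "e - b \<noteq> {}"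
    unfolding coboundary_iff[OF simple assms(2)] image_iff Bex_def by blast
  moreover have "g ` e - g ` b = g ` (e - b)"
    using inj_on_image_set_diff[OF A_inj[OF assms(1)], of e b] edge_subset[OF e(2)] assms(2) by blast
  ultimately have "f \<in> edges \<Delta>" "f \<inter> g ` b \<noteq> {}" "f - g ` b \<noteq> {}"
    using A_edges[OF assms(1) edge_subset[OF e(2)]] by auto
  then show "f \<in> coboundary \<Delta> (g ` b)"
    by (simp add: coboundary_iff[OF simple A_subset[OF assms]])
qed

lemma coboundary_image:
  assumes "g \<in> A" "b \<subseteq> verts \<Delta>"
  shows "coboundary \<Delta> (g ` b) = (`) g ` coboundary \<Delta> b"
proof
  obtain h where h: "h \<in> A" "\<And>b. b \<subseteq> verts \<Delta> \<Longrightarrow> h ` g ` b = b" "\<And>b. b \<subseteq> verts \<Delta> \<Longrightarrow> g ` h ` b = b"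
    using A_image_inverse[OF assms(1)] by auto
  show "coboundary \<Delta> (g ` b) \<subseteq> (`) g ` coboundary \<Delta> b"
  proof
    fix e assume e: "e \<in> coboundary \<Delta> (g ` b)"
    then have "h ` e \<in> coboundary \<Delta> b"
      using coboundary_image_subset[OF h(1) A_subset[OF assms]] h(2)[OF assms(2)] by auto
    moreover have "g ` h ` e = e"
      using e coboundary_subset_edges edge_subset by (intro h(3)) blast
    ultimately show "e \<in> (`) g ` coboundary \<Delta> b" by (metis image_eqI)
  qed
qed (rule coboundary_image_subset[OF assms])

lemma card_coboundary_image:
  assumes "g \<in> A" "b \<subseteq> verts \<Delta>"
  shows "card (coboundary \<Delta> (g ` b)) = card (coboundary \<Delta> b)"
proof -
  have "inj_on ((`) g) (coboundary \<Delta> b)"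
    using A_inj[OF assms(1)] coboundary_subset_edges[of \<Delta> b] edge_subset
    by (intro inj_onI) (metis inj_on_image_eq_iff subsetD)
  then show ?thesis by (simp add: coboundary_image[OF assms] card_image)
qed

lemma cut_image: "g \<in> A \<Longrightarrow> cut \<Delta> b \<Longrightarrow> cut \<Delta> (g ` b)"
  by (simp add: cut_def coboundary_image A_subset)

lemma crossing_image:
  assumes "g \<in> A" "a \<subseteq> verts \<Delta>" "b \<subseteq> verts \<Delta>"
  shows "crossing \<Delta> (g ` a) (g ` b) \<longleftrightarrow> crossing \<Delta> a b"
proof -
  note inj = A_inj[OF assms(1)]
  have "g ` a \<inter> g ` b = g ` (a \<inter> b)" "g ` a - g ` b = g ` (a - b)" "g ` b - g ` a = g ` (b - a)"
    "verts \<Delta> - (g ` a \<union> g ` b) = g ` (verts \<Delta> - (a \<union> b))"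
    using inj assms(2,3) A_surj[OF assms(1)]
    by (simp_all add: inj_on_image_Int[of g "verts \<Delta>"] inj_on_image_set_diff[of g "verts \<Delta>"] image_Un
        Diff_subset_conv le_supI2)
  then show ?thesis by (simp add: crossing_def)
qed

lemma cut_hom_image:
  assumes "g \<in> A" "cut_hom \<Delta> \<omega>"
  shows "cut_hom \<Delta> (\<lambda>b. \<omega> (g ` b))"
proof -
  note inj = A_inj[OF assms(1)]
  have "\<omega> (g ` (a \<inter> b)) = (\<omega> (g ` a) \<and> \<omega> (g ` b))" if "cut \<Delta> a" "cut \<Delta> b" for a b
    using that inj_on_image_Int[OF inj, of a b]
      cut_hom_Int[OF assms(2) cut_image[OF assms(1) that(1)] cut_image[OF assms(1) that(2)]]
    by (simp add: cut_def)
  moreover have "\<omega> (g ` (verts \<Delta> - a)) = (\<not> \<omega> (g ` a))" if "cut \<Delta> a" for a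
    using that inj_on_image_set_diff[OF inj, of "verts \<Delta>" a] A_surj[OF assms(1)]
      cut_hom_compl[OF assms(2) cut_image[OF assms(1) that]]
    by (simp add: cut_def)
  ultimately show ?thesis by (simp add: cut_hom_def)
qed

text \<open>The new pair enters only through its values on vertex sets of the graph. Thus the lemma
  also applies when translating back, where composing with both maps returns the original
  homomorphisms on such sets only.\<close>

lemma minimal_sep_image:
  assumes "g \<in> A" "minimal_sep \<Delta> \<omega> \<eta> c" "h \<in> A"
    "\<And>b. b \<subseteq> verts \<Delta> \<Longrightarrow> h ` g ` b = b" "\<And>b. b \<subseteq> verts \<Delta> \<Longrightarrow> \<omega>' b = \<omega> (h ` b) \<and> \<eta>' b = \<eta> (h ` b)"
  shows "minimal_sep \<Delta> \<omega>' \<eta>' (g ` c)"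
proof -
  have c: "cut \<Delta> c" "c \<subseteq> verts \<Delta>" "\<omega> c \<noteq> \<eta> c" using assms(2) by (auto simp: minimal_sep_def cut_def)
  have "card (coboundary \<Delta> (g ` c)) \<le> card (coboundary \<Delta> a)" if "cut \<Delta> a" "\<omega>' a \<noteq> \<eta>' a" for a
  proof -
    have a: "a \<subseteq> verts \<Delta>" using that by (simp add: cut_def)
    have "card (coboundary \<Delta> c) \<le> card (coboundary \<Delta> (h ` a))"
      using assms(2) that cut_image[OF assms(3)] assms(5)[OF a] by (auto simp: minimal_sep_def)
    then show ?thesis using card_coboundary_image assms(1,3) a c by simp
  qed
  moreover have "cut \<Delta> (g ` c)" using cut_image[OF assms(1)] c by blast
  moreover have "\<omega>' (g ` c) \<noteq> \<eta>' (g ` c)"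
    using assms(5)[OF A_subset[OF assms(1) c(2)]] assms(4)[OF c(2)] c(3) by simp
  ultimately show ?thesis unfolding minimal_sep_def by blast
qed

lemma minimal_cuts_image:
  assumes "g \<in> A" "c \<in> minimal_cuts \<Delta> K"
  shows "g ` c \<in> minimal_cuts \<Delta> K"
proof -
  obtain h where h: "h \<in> A" "\<And>b. b \<subseteq> verts \<Delta> \<Longrightarrow> h ` g ` b = b" "\<And>b. b \<subseteq> verts \<Delta> \<Longrightarrow> g ` h ` b = b"
    using A_image_inverse[OF assms(1)] by auto
  obtain \<omega> \<eta> where *: "cut_hom \<Delta> \<omega>" "cut_hom \<Delta> \<eta>" "minimal_sep \<Delta> \<omega> \<eta> c"
    using assms(2) by (auto simp: minimal_cuts_def)
  have "minimal_sep \<Delta> (\<lambda>b. \<omega> (h ` b)) (\<lambda>b. \<eta> (h ` b)) (g ` c)"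
    using minimal_sep_image[OF assms(1) *(3) h(1,2)] by auto
  moreover have "c \<subseteq> verts \<Delta>" using *(3) by (simp add: minimal_sep_def cut_def)
  ultimately show ?thesis
    using cut_hom_image[OF h(1)] * assms card_coboundary_image[OF assms(1)]
    unfolding minimal_cuts_def mem_Collect_eq by auto
qed

lemma crossing_number_image:
  assumes "g \<in> A" "c \<subseteq> verts \<Delta>"
  shows "crossing_number \<Delta> K (g ` c) = crossing_number \<Delta> K c"
proof -
  obtain h where h: "h \<in> A" "\<And>b. b \<subseteq> verts \<Delta> \<Longrightarrow> h ` g ` b = b" "\<And>b. b \<subseteq> verts \<Delta> \<Longrightarrow> g ` h ` b = b"
    using A_image_inverse[OF assms(1)] by auto
  have V: "d \<subseteq> verts \<Delta>" if "d \<in> minimal_cuts \<Delta> K" for d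
    using that by (auto simp: minimal_cuts_def minimal_sep_def cut_def)
  have "bij_betw ((`) g) {d \<in> minimal_cuts \<Delta> K. crossing \<Delta> d c} {d \<in> minimal_cuts \<Delta> K. crossing \<Delta> d (g ` c)}"
  proof (rule bij_betw_byWitness[where f' = "(`) h"])
    show "(`) h ` {d \<in> minimal_cuts \<Delta> K. crossing \<Delta> d (g ` c)} \<subseteq> {d \<in> minimal_cuts \<Delta> K. crossing \<Delta> d c}"
      using minimal_cuts_image[OF h(1)] crossing_image[OF h(1) V A_subset[OF assms]] h(2)[OF assms(2)] by auto
  qed (use V h minimal_cuts_image[OF assms(1)] crossing_image[OF assms(1) V assms(2)] in auto)
  then show ?thesis by (simp add: crossing_number_def bij_betw_same_card)
qed

lemma optimal_cuts_image:
  assumes "g \<in> A" "c \<in> optimal_cuts \<Delta> K"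
  shows "g ` c \<in> optimal_cuts \<Delta> K"
proof -
  obtain h where h: "h \<in> A" "\<And>b. b \<subseteq> verts \<Delta> \<Longrightarrow> h ` g ` b = b" "\<And>b. b \<subseteq> verts \<Delta> \<Longrightarrow> g ` h ` b = b"
    using A_image_inverse[OF assms(1)] by auto
  obtain \<omega> \<eta> where *: "cut_hom \<Delta> \<omega>" "cut_hom \<Delta> \<eta>" "optimal_sep \<Delta> K \<omega> \<eta> c"
    using assms(2) by (auto simp: optimal_cuts_def)
  let ?\<omega> = "\<lambda>b. \<omega> (h ` b)" and ?\<eta> = "\<lambda>b. \<eta> (h ` b)"
  have c: "c \<subseteq> verts \<Delta>" "minimal_sep \<Delta> \<omega> \<eta> c"
    using *(3) by (auto simp: optimal_sep_def minimal_sep_def cut_def)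
  have "minimal_sep \<Delta> ?\<omega> ?\<eta> (g ` c)"
    using minimal_sep_image[OF assms(1) c(2) h(1,2)] by auto
  moreover have "crossing_number \<Delta> K (g ` c) \<le> crossing_number \<Delta> K a" if a: "minimal_sep \<Delta> ?\<omega> ?\<eta> a" for a
  proof -
    have aV: "a \<subseteq> verts \<Delta>" using a by (auto simp: minimal_sep_def cut_def)
    have "minimal_sep \<Delta> \<omega> \<eta> (h ` a)"
      using minimal_sep_image[OF h(1) a assms(1) h(3)] h(2) by auto
    then have "crossing_number \<Delta> K c \<le> crossing_number \<Delta> K (h ` a)"
      using *(3) by (simp add: optimal_sep_def)
    then show ?thesis using crossing_number_image assms(1) h(1) c(1) aV by simp
  qed
  ultimately have "optimal_sep \<Delta> K ?\<omega> ?\<eta> (g ` c)"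
    using *(3) card_coboundary_image[OF assms(1) c(1)] by (simp add: optimal_sep_def)
  then show ?thesis using cut_hom_image[OF h(1)] * by (auto simp: optimal_cuts_def)
qed

section \<open>Traces of optimal cuts on generators\<close>

lemma optimal_cut_trace_maximal:
  assumes "c \<in> optimal_cuts \<Delta> K" "card (coboundary \<Delta> c) \<noteq> 1"
  shows "\<exists>Z \<in> R. trace_maximal \<Delta> K Z c"
proof (rule ccontr)
  assume "\<not> ?thesis"
  note none = this[unfolded trace_maximal_def]
  have bond: "bond \<Delta> d" "d \<subseteq> verts \<Delta>" "card (coboundary \<Delta> d) \<le> K" if "d \<in> optimal_cuts \<Delta> K" for d
    using minimal_cuts_bond[OF optimal_cuts_minimal[OF that]] by (auto simp: bond_def cut_def)
  note c = bond[OF assms(1)]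
  let ?F = "coboundary \<Delta> c"
  have fin: "finite ?F" and ne: "?F \<noteq> {}" using c(1) by (auto simp: bond_def cut_def)
  \<comment> \<open>The larger cuts agreeing with \<open>c\<close> on some generator that meets its
    boundary. Such agreement puts an edge of the boundary of \<open>c\<close> into the boundary of
    \<open>s\<close>, so the finitely many edges of \<open>?F\<close> leave only finitely many
    candidates.\<close>
  let ?S = "{s \<in> optimal_cuts \<Delta> K. c \<subset> s \<and> (\<exists>Z \<in> R. Z \<inter> ?F \<noteq> {} \<and> s \<inter> \<Union>Z = c \<inter> \<Union>Z)}"
  have ext: "\<exists>s. s \<in> ?S \<and> s \<inter> \<Union>Z = c \<inter> \<Union>Z" if Z: "Z \<in> R" "Z \<inter> ?F \<noteq> {}" for Z
  proof -
    obtain s where s: "s \<in> optimal_cuts \<Delta> K" "c \<subset> s" "s \<inter> \<Union>Z = c \<inter> \<Union>Z"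
      using bspec[OF none[unfolded bex_simps] Z(1)] Z(2) by auto
    then have "s \<in> ?S" by (intro CollectI conjI bexI[of _ Z] Z)
    then show ?thesis using s(3) by (intro exI conjI)
  qed
  have trace: "e \<in> coboundary \<Delta> s \<longleftrightarrow> e \<in> ?F" if "s \<inter> \<Union>Z = c \<inter> \<Union>Z" "e \<in> Z" "s \<subseteq> verts \<Delta>" for s Z e
    unfolding coboundary_iff[OF simple that(3)] coboundary_iff[OF simple c(2)]
    using that(1,2) by blast
  have S_edge: "\<exists>e \<in> ?F. e \<in> coboundary \<Delta> s" if "s \<in> ?S" for s
    using that trace bond(2) by blast
  \<comment> \<open>Here a second boundary edge is used: a single edge is then a proper part of the
    boundary, so linkedness supplies a generator through it.\<close>
  have "?S \<noteq> {}"
  proof -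
    obtain e where e: "e \<in> ?F" using ne by blast
    have "{e} \<noteq> ?F" using assms(2) by (metis card_1_singleton_iff One_nat_def)
    then obtain Z where "Z \<in> R" "Z \<inter> {e} \<noteq> {}" using bond_linked[OF c(1), of "{e}"] e by blast
    then have "\<exists>s. s \<in> ?S \<and> s \<inter> \<Union>Z = c \<inter> \<Union>Z" using e by (intro ext) auto
    then show ?thesis by (elim exE conjE) (simp only: ex_in_conv[symmetric], rule exI)
  qed
  moreover have "finite ?S"
  proof (rule finite_subset)
    let ?B = "\<lambda>e. {d. bond \<Delta> d \<and> e \<in> coboundary \<Delta> d \<and> card (coboundary \<Delta> d) \<le> K}"
    show "?S \<subseteq> (\<Union>e \<in> ?F. ?B e)"
    proof
      fix s assume s: "s \<in> ?S"
      obtain e where e: "e \<in> ?F" "e \<in> coboundary \<Delta> s" using S_edge[OF s] by auto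
      moreover have "s \<in> ?B e" using e(2) s bond(1,3) by simp
      ultimately show "s \<in> (\<Union>e \<in> ?F. ?B e)" by (intro UN_I)
    qed
    show "finite (\<Union>e \<in> ?F. ?B e)"
      using fin by (intro finite_UN_I finite_bonds_through_edge subsetD[OF coboundary_subset_edges])
  qed
  ultimately obtain s where s: "s \<in> ?S" and min: "\<And>t. t \<in> ?S \<Longrightarrow> t \<subseteq> s \<Longrightarrow> s = t"
    by (meson finite_has_minimal)
  then have sV: "s \<subseteq> verts \<Delta>" "bond \<Delta> s" and cs: "c \<subset> s" using bond by auto
  have "?F \<subseteq> coboundary \<Delta> s"
  proof (rule ccontr)
    \<comment> \<open>Linkedness yields a generator \<open>Z\<close> with an edge in both boundaries
      and one in the boundary of \<open>c\<close> only. A larger cut \<open>t\<close> agreeing with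
      \<open>c\<close> on \<open>Z\<close> shares the first edge with \<open>s\<close>, whose ends
      witness a common vertex and a common non-vertex, so nestedness makes \<open>s\<close> and
      \<open>t\<close> comparable. Minimality gives \<open>c \<subset> s \<subseteq> t\<close>, and
      \<open>s\<close> is squeezed to the trace of \<open>c\<close> on \<open>Z\<close>,
      contradicting the second edge.\<close>
    assume "\<not> ?thesis"
    then have "?F \<inter> coboundary \<Delta> s \<noteq> ?F" by blast
    then obtain Z where Z: "Z \<in> R" "Z \<inter> (?F \<inter> coboundary \<Delta> s) \<noteq> {}" "Z \<inter> (?F - ?F \<inter> coboundary \<Delta> s) \<noteq> {}"
      using bond_linked[OF c(1), of "?F \<inter> coboundary \<Delta> s"] S_edge[OF s] by blast
    have "Z \<inter> ?F \<noteq> {}" using Z(2) by auto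
    from ext[OF Z(1) this] obtain t where tS: "t \<in> ?S" and "t \<inter> \<Union>Z = c \<inter> \<Union>Z" by (elim exE conjE)
    then have t: "t \<in> optimal_cuts \<Delta> K" "c \<subset> t" "t \<inter> \<Union>Z = c \<inter> \<Union>Z" by simp_all
    obtain e where e: "e \<in> Z" "e \<in> ?F" "e \<in> coboundary \<Delta> s" using Z(2) by blast
    have et: "e \<in> coboundary \<Delta> t" using trace[OF t(3) e(1)] bond(2)[OF t(1)] e by blast
    obtain x y where xy: "e = {x, y}" "x \<in> verts \<Delta>" "y \<in> verts \<Delta>"
      using simple_graph_edgeE[OF simple] e(2) coboundary_subset_edges by (metis subsetD)
    have "e \<in> edges \<Delta>" using e coboundary_subset_edges by blast
    then have "(x \<in> c) \<noteq> (y \<in> c)" "(x \<in> s) \<noteq> (y \<in> s)" "(x \<in> t) \<noteq> (y \<in> t)"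
      using e et coboundary_pair[OF simple c(2), of x y] coboundary_pair[OF simple sV(1), of x y]
        coboundary_pair[OF simple bond(2)[OF t(1)], of x y] unfolding xy by blast+
    then have "s \<inter> t \<noteq> {} \<and> verts \<Delta> - (s \<union> t) \<noteq> {}" using cs t(2) xy by blast
    moreover have "\<not> crossing \<Delta> s t" using optimal_cuts_nested s t(1) by blast
    ultimately have "s \<subseteq> t \<or> t \<subseteq> s" unfolding crossing_def by blast
    then have "s \<subseteq> t" using min[OF tS] by blast
    then have "s \<inter> \<Union>Z = c \<inter> \<Union>Z" using cs t(3) by blast
    then show False using trace[of s Z] Z(3) sV(1) by blast
  qed
  then have "?F = coboundary \<Delta> s" using sV(2) c(2) ne by (auto simp: bond_def)
  then have "c = s \<or> c = verts \<Delta> - s" using coboundary_inj c(2) sV(1) by blast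
  then have "c = {}" using cs by blast
  then show False using ne by (simp add: coboundary_def)
qed

text \<open>Since \<open>Z\<close> contains a boundary edge of \<open>c\<close>, equal traces give
  the two cuts a common vertex and a common non-vertex. Nested cuts of this kind are comparable, and
  maximality excludes proper inclusion in either direction.\<close>

lemma optimal_cut_trace_unique:
  assumes "c \<in> optimal_cuts \<Delta> K" "d \<in> optimal_cuts \<Delta> K"
    "trace_maximal \<Delta> K Z c" "trace_maximal \<Delta> K Z d" "c \<inter> \<Union>Z = d \<inter> \<Union>Z"
  shows "c = d"
proof -
  have V: "c \<subseteq> verts \<Delta>"
    using minimal_cuts_bond[OF optimal_cuts_minimal[OF assms(1)]] by (auto simp: bond_def cut_def)
  obtain e where e: "e \<in> Z" "e \<in> coboundary \<Delta> c" using assms(3) unfolding trace_maximal_def by blast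
  then have "e \<inter> c \<noteq> {}" "e - c \<noteq> {}" "e \<subseteq> verts \<Delta>"
    using coboundary_iff[OF simple V] edge_subset by blast+
  then have "c \<inter> d \<noteq> {} \<and> verts \<Delta> - (c \<union> d) \<noteq> {}" using assms(5) e(1) by blast
  moreover have "\<not> crossing \<Delta> c d" using optimal_cuts_nested assms(1,2) by blast
  ultimately have "c \<subseteq> d \<or> d \<subseteq> c" unfolding crossing_def by blast
  then show ?thesis using assms unfolding trace_maximal_def by (metis psubsetI)
qed

text \<open>The bound counts different sizes and does not mention \<open>K\<close>: sizes are
  invariant under translation, so a representative generator together with a subset of its vertices
  accounts for each size. The \<open>Suc\<close> allows for size 1. Finiteness is stated separately
  because \<open>card\<close> of an infinite set is 0.\<close>

lemma optimal_cut_sizes: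
  "card ((\<lambda>c. card (coboundary \<Delta> c)) ` optimal_cuts \<Delta> K) \<le> Suc (card (SIGMA Z:R\<^sub>0. Pow (\<Union>Z)))"
  "finite ((\<lambda>c. card (coboundary \<Delta> c)) ` optimal_cuts \<Delta> K)"
proof -
  let ?O = "optimal_cuts \<Delta> K" and ?P = "SIGMA Z:R\<^sub>0. Pow (\<Union>Z)"
  let ?traced = "trace_maximal \<Delta> K"
  let ?T = "{c \<in> ?O. \<exists>Z \<in> R\<^sub>0. ?traced Z c}"
  have V: "c \<subseteq> verts \<Delta>" if "c \<in> ?O" for c
    using minimal_cuts_bond[OF optimal_cuts_minimal[OF that]] by (auto simp: bond_def cut_def)
  have finZ: "finite (\<Union>Z)" if "Z \<in> R\<^sub>0" for Z
  proof (rule finite_Union)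
    show "finite Z" using that R0_R R_finite by blast
    show "finite e" if "e \<in> Z" for e
    proof -
      have "e \<in> edges \<Delta>" using that \<open>Z \<in> R\<^sub>0\<close> R0_R R_edges by blast
      then show ?thesis using simple by (metis simple_graph_edgeE finite.simps)
    qed
  qed
  have finP: "finite ?P" using R0_finite finZ by simp
  \<comment> \<open>One generator is chosen per cut. Recording it beside the trace makes equal
    values of \<open>tr\<close> refer to the same \<open>Z\<close>, as uniqueness of traces
    requires.\<close>
  define tr where "tr c = (let Z = SOME Z. Z \<in> R\<^sub>0 \<and> ?traced Z c in (Z, c \<inter> \<Union>Z))" for c
  have tr: "\<exists>Z. tr c = (Z, c \<inter> \<Union>Z) \<and> Z \<in> R\<^sub>0 \<and> ?traced Z c" if "c \<in> ?T" for c
    unfolding tr_def Let_def using someI_ex[of "\<lambda>Z. Z \<in> R\<^sub>0 \<and> ?traced Z c"] that by blast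
  have inj: "inj_on tr ?T"
  proof (rule inj_onI)
    fix c d assume cd: "c \<in> ?T" "d \<in> ?T" "tr c = tr d"
    obtain Z where Z: "tr c = (Z, c \<inter> \<Union>Z)" "Z \<in> R\<^sub>0" "?traced Z c" using tr[OF cd(1)] by blast
    obtain Y where Y: "tr d = (Y, d \<inter> \<Union>Y)" "?traced Y d" using tr[OF cd(2)] by blast
    have "Y = Z \<and> c \<inter> \<Union>Z = d \<inter> \<Union>Z" using Z(1) Y(1) cd(3) by (metis prod.inject)
    then show "c = d" using optimal_cut_trace_unique[of c K d Z] Z Y cd(1,2) by simp
  qed
  have sub: "tr ` ?T \<subseteq> ?P" using tr by fastforce
  have fin: "finite ?T" using inj sub finP by (meson finite_imageD finite_subset)
  have cT: "card ?T \<le> card ?P" using card_inj_on_le[OF inj sub finP] .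
  \<comment> \<open>A cut with at least two boundary edges is moved by a translation that takes its
    generator into \<open>R\<^sub>0\<close>. Trace maximality is carried along because the inverse
    translation brings any larger competitor back to the original cut.\<close>
  have "card (coboundary \<Delta> c) \<in> insert 1 ((\<lambda>c. card (coboundary \<Delta> c)) ` ?T)" if c: "c \<in> ?O" for c
  proof (cases "card (coboundary \<Delta> c) = 1")
    case False
    obtain Z where Z: "Z \<in> R" "?traced Z c" using optimal_cut_trace_maximal[OF c False] by blast
    obtain g where g: "g \<in> A" "(`) g ` Z \<in> R\<^sub>0" using R_orbits[OF Z(1)] by blast
    obtain h where h: "h \<in> A" "\<And>b. b \<subseteq> verts \<Delta> \<Longrightarrow> h ` g ` b = b" "\<And>b. b \<subseteq> verts \<Delta> \<Longrightarrow> g ` h ` b = b"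
      using A_image_inverse[OF g(1)] by auto
    have ZV: "\<Union>Z \<subseteq> verts \<Delta>" using Z(1) R_edges edge_subset by blast
    have UZ: "\<Union>((`) g ` Z) = g ` \<Union>Z" by blast
    have gc: "g ` c \<in> ?O" using optimal_cuts_image[OF g(1) c] .
    have "?traced ((`) g ` Z) (g ` c)"
      unfolding trace_maximal_def
    proof (intro conjI ballI impI notI)
      assume "(`) g ` Z \<inter> coboundary \<Delta> (g ` c) = {}"
      then show False using Z(2) unfolding trace_maximal_def coboundary_image[OF g(1) V[OF c]] by blast
    next
      fix s assume s: "s \<in> ?O" "g ` c \<subset> s" "s \<inter> \<Union>((`) g ` Z) = g ` c \<inter> \<Union>((`) g ` Z)"
      have hs: "h ` s \<in> ?O" using optimal_cuts_image[OF h(1) s(1)] .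
      have "c \<subseteq> h ` s" using s(2) h(2)[OF V[OF c]] by blast
      moreover have "c \<noteq> h ` s" using s(2) h(3)[OF V[OF s(1)]] by blast
      moreover have "h ` s \<inter> \<Union>Z = c \<inter> \<Union>Z"
      proof -
        have "h ` s \<inter> \<Union>Z = h ` s \<inter> h ` g ` \<Union>Z" using h(2)[OF ZV] by simp
        also have "\<dots> = h ` (s \<inter> g ` \<Union>Z)"
          using inj_on_image_Int[OF A_inj[OF h(1)], of s "g ` \<Union>Z"] V[OF s(1)] A_subset[OF g(1) ZV] by simp
        also have "\<dots> = h ` (g ` c \<inter> g ` \<Union>Z)" using s(3) unfolding UZ by simp
        also have "\<dots> = h ` g ` (c \<inter> \<Union>Z)"
          using inj_on_image_Int[OF A_inj[OF g(1)], of c "\<Union>Z"] V[OF c] ZV by simp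
        also have "\<dots> = c \<inter> \<Union>Z" using h(2)[of "c \<inter> \<Union>Z"] ZV by blast
        finally show ?thesis .
      qed
      ultimately show False using Z(2) hs unfolding trace_maximal_def by (metis psubsetI)
    qed
    then have "g ` c \<in> ?T" using gc g(2) by (intro CollectI conjI bexI)
    then show ?thesis unfolding card_coboundary_image[OF g(1) V[OF c], symmetric]
      by (intro insertI2 imageI)
  qed simp
  then have sub': "(\<lambda>c. card (coboundary \<Delta> c)) ` ?O \<subseteq> insert 1 ((\<lambda>c. card (coboundary \<Delta> c)) ` ?T)"
    by (rule image_subsetI)
  have fin': "finite (insert 1 ((\<lambda>c. card (coboundary \<Delta> c)) ` ?T))" using fin by simp
  show "finite ((\<lambda>c. card (coboundary \<Delta> c)) ` ?O)" using finite_subset[OF sub' fin'] .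
  have "card ((\<lambda>c. card (coboundary \<Delta> c)) ` ?O) \<le> card (insert 1 ((\<lambda>c. card (coboundary \<Delta> c)) ` ?T))"
    using card_mono[OF fin' sub'] .
  also have "\<dots> \<le> Suc (card ((\<lambda>c. card (coboundary \<Delta> c)) ` ?T))" using fin by (simp add: card_insert_if)
  also have "\<dots> \<le> Suc (card ?P)" using card_image_le[OF fin] cT order_trans by blast
  finally show "card ((\<lambda>c. card (coboundary \<Delta> c)) ` ?O) \<le> Suc (card ?P)" .
qed

theorem bounded_separation:
  "\<exists>k. \<forall>\<omega> \<eta>. cut_hom \<Delta> \<omega> \<longrightarrow> cut_hom \<Delta> \<eta> \<longrightarrow> (\<exists>b. cut \<Delta> b \<and> \<omega> b \<noteq> \<eta> b) \<longrightarrow>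
     (\<exists>b. cut \<Delta> b \<and> \<omega> b \<noteq> \<eta> b \<and> card (coboundary \<Delta> b) \<le> k)"
proof -
  let ?s = "\<lambda>c. card (coboundary \<Delta> c)"
  let ?M = "{c. \<exists>\<omega> \<eta>. cut_hom \<Delta> \<omega> \<and> cut_hom \<Delta> \<eta> \<and> minimal_sep \<Delta> \<omega> \<eta> c}"
  have "finite (?s ` ?M)"
  proof (rule ccontr)
    assume "infinite (?s ` ?M)"
    \<comment> \<open>\<open>D\<close> has one size more than optimal cuts can have for any value of
      \<open>K\<close>; taking \<open>K = Max D\<close> makes all sizes in \<open>D\<close> occur
      among them, since passing from a minimal to an optimal cut keeps the size.\<close>
    then obtain D where D: "D \<subseteq> ?s ` ?M" "finite D" "card D = Suc (Suc (card (SIGMA Z:R\<^sub>0. Pow (\<Union>Z))))"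
      using infinite_arbitrarily_large by blast
    have "D \<subseteq> ?s ` optimal_cuts \<Delta> (Max D)"
    proof
      fix n assume n: "n \<in> D"
      then obtain c \<omega> \<eta> where *: "n = ?s c" "cut_hom \<Delta> \<omega>" "cut_hom \<Delta> \<eta>" "minimal_sep \<Delta> \<omega> \<eta> c"
        using D(1) by blast
      have "?s c \<le> Max D" using n * D(2) by simp
      then obtain d where "optimal_sep \<Delta> (Max D) \<omega> \<eta> d" "?s d = ?s c"
        using optimal_sep_exists[OF *(4)] by blast
      then have "d \<in> optimal_cuts \<Delta> (Max D)" "n = ?s d" using * by (auto simp: optimal_cuts_def)
      then show "n \<in> ?s ` optimal_cuts \<Delta> (Max D)" by blast
    qed
    then have "card D \<le> card (?s ` optimal_cuts \<Delta> (Max D))"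
      using optimal_cut_sizes(2) card_mono by blast
    then show False using optimal_cut_sizes(1)[of "Max D"] D(3) by simp
  qed
  then obtain k where k: "\<And>n. n \<in> ?s ` ?M \<Longrightarrow> n \<le> k" by (meson finite_nat_set_iff_bounded_le)
  have "\<exists>b. cut \<Delta> b \<and> \<omega> b \<noteq> \<eta> b \<and> card (coboundary \<Delta> b) \<le> k"
    if hom: "cut_hom \<Delta> \<omega>" "cut_hom \<Delta> \<eta>" and b: "cut \<Delta> b" "\<omega> b \<noteq> \<eta> b" for \<omega> \<eta> b
  proof -
    obtain c where c: "cut \<Delta> c \<and> \<omega> c \<noteq> \<eta> c"
      "\<And>a. cut \<Delta> a \<and> \<omega> a \<noteq> \<eta> a \<Longrightarrow> ?s c \<le> ?s a"
      using ex_has_least_nat[of "\<lambda>c. cut \<Delta> c \<and> \<omega> c \<noteq> \<eta> c" b ?s] b by blast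
    then have "minimal_sep \<Delta> \<omega> \<eta> c" by (simp add: minimal_sep_def)
    then have "?s c \<in> ?s ` ?M" using hom by blast
    then show ?thesis using k c by blast
  qed
  then show ?thesis by blast
qed

end

section \<open>Coboundaries and the cycle space\<close>

fun walk_parity :: "'v set set \<Rightarrow> 'v list \<Rightarrow> bool" where
  "walk_parity F (x # y # xs) = (({x, y} \<in> F) \<noteq> walk_parity F (y # xs))"
| "walk_parity F _ = False"

lemma walk_parity_append:
  "xs \<noteq> [] \<Longrightarrow> ys \<noteq> [] \<Longrightarrow>
    walk_parity F (xs @ ys) = (walk_parity F xs \<noteq> (({last xs, hd ys} \<in> F) \<noteq> walk_parity F ys))"
proof (induction F xs rule: walk_parity.induct)
  case ("2_2" F v)
  then show ?case by (cases ys) auto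
qed auto

lemma walk_parity_rev: "walk_parity F (rev xs) = walk_parity F xs"
proof (induction xs)
  case (Cons x xs)
  show ?case
  proof (cases xs)
    case (Cons y ys)
    then have "walk_parity F (rev xs @ [x]) = (walk_parity F xs \<noteq> ({y, x} \<in> F))"
      using walk_parity_append[of "rev xs" "[x]" F] Cons.IH by (simp add: last_rev del: rev.simps)
    then show ?thesis using Cons by (simp add: insert_commute) blast
  qed simp
qed simp

lemma walk_parity_split:
  "walk_parity F (xs @ v # ys) = (walk_parity F (xs @ [v]) \<noteq> walk_parity F (v # ys))"
proof (cases "xs = [] \<or> ys = []")
  case False
  then show ?thesis
    using walk_parity_append[of "xs @ [v]" ys F] by (cases ys) auto
qed auto

lemma walk_parity_card:
  "walk_parity F xs \<longleftrightarrow> odd (card {i. Suc i < length xs \<and> {xs ! i, xs ! Suc i} \<in> F})"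
proof (induction F xs rule: walk_parity.induct)
  case (1 F x y xs)
  let ?A = "{i. Suc i < length (y # xs) \<and> {(y # xs) ! i, (y # xs) ! Suc i} \<in> F}"
  have eq: "{i. Suc i < length (x # y # xs) \<and> {(x # y # xs) ! i, (x # y # xs) ! Suc i} \<in> F} =
      (if {x, y} \<in> F then insert 0 (Suc ` ?A) else Suc ` ?A)"
  proof (rule Set.set_eqI)
    fix i
    show "i \<in> {i. Suc i < length (x # y # xs) \<and> {(x # y # xs) ! i, (x # y # xs) ! Suc i} \<in> F} \<longleftrightarrow>
      i \<in> (if {x, y} \<in> F then insert 0 (Suc ` ?A) else Suc ` ?A)"
      by (cases i) auto
  qed
  have fin: "finite (Suc ` ?A)" by (intro finite_imageI finite_subset[of ?A "{..length (y # xs)}"]) auto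
  have "card (Suc ` ?A) = card ?A" by (rule card_image) simp
  then show ?case using 1 fin unfolding eq by auto
qed auto

lemma walk_parity_coboundary:
  assumes "simple_graph \<Delta>" "b \<subseteq> verts \<Delta>"
  shows "xs \<noteq> [] \<Longrightarrow> successively (\<lambda>x y. {x, y} \<in> edges \<Delta>) xs \<Longrightarrow>
    walk_parity (coboundary \<Delta> b) xs \<longleftrightarrow> (hd xs \<in> b) \<noteq> (last xs \<in> b)"
proof (induction xs rule: induct_list012)
  case (3 x y zs)
  then show ?case using coboundary_pair[OF assms, of x y] by auto
qed auto

text \<open>Steps of the walk may be counted as edges because a cycle of length at least 3 repeats
  no edge; for two vertices both steps would use the same edge.\<close>

lemma walk_parity_cycle:
  assumes "3 \<le> length vs" "distinct vs"
  shows "walk_parity F (vs @ [hd vs]) \<longleftrightarrow> odd (card (cycle_edges vs \<inter> F))"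
proof -
  let ?n = "length vs" and ?e = "\<lambda>i. {vs ! i, vs ! (Suc i mod length vs)}"
  have ne: "vs \<noteq> []" using assms(1) by auto
  have nth: "(vs @ [hd vs]) ! i = vs ! i" "(vs @ [hd vs]) ! Suc i = vs ! (Suc i mod ?n)" if "i < ?n" for i
    using that ne by (auto simp: nth_append hd_conv_nth mod_Suc)
  have eq: "{i. Suc i < length (vs @ [hd vs]) \<and> {(vs @ [hd vs]) ! i, (vs @ [hd vs]) ! Suc i} \<in> F} =
      {i. i < ?n \<and> ?e i \<in> F}"
    using nth by auto
  have inj: "inj_on ?e {i. i < ?n \<and> ?e i \<in> F}"
  proof (rule inj_onI)
    fix i j assume ij: "i \<in> {i. i < ?n \<and> ?e i \<in> F}" "j \<in> {i. i < ?n \<and> ?e i \<in> F}" "?e i = ?e j"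
    have lt: "i < ?n" "j < ?n" "Suc i mod ?n < ?n" "Suc j mod ?n < ?n" using ij ne by auto
    have "(vs ! i = vs ! j) \<or> (vs ! i = vs ! (Suc j mod ?n) \<and> vs ! (Suc i mod ?n) = vs ! j)"
      using ij(3) by (auto simp: doubleton_eq_iff)
    then have "i = j \<or> (i = Suc j mod ?n \<and> Suc i mod ?n = j)"
      using lt assms(2) by (simp add: nth_eq_iff_index_eq)
    then show "i = j" using lt assms(1) by (auto simp: mod_Suc split: if_splits)
  qed
  have im: "?e ` {i. i < ?n \<and> ?e i \<in> F} = cycle_edges vs \<inter> F"
    by (auto simp: cycle_edges_def)
  show ?thesis unfolding walk_parity_card eq card_image[OF inj, symmetric] im ..
qed

lemma successively_cycle_iff:
  assumes "vs \<noteq> []"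
  shows "successively (\<lambda>x y. {x, y} \<in> E) (vs @ [hd vs]) \<longleftrightarrow> cycle_edges vs \<subseteq> E"
proof -
  have nth: "(vs @ [hd vs]) ! i = vs ! i \<and> (vs @ [hd vs]) ! Suc i = vs ! (Suc i mod length vs)"
    if "i < length vs" for i
    using that assms by (auto simp: nth_append hd_conv_nth mod_Suc)
  have "successively (\<lambda>x y. {x, y} \<in> E) (vs @ [hd vs]) \<longleftrightarrow>
      (\<forall>i < length vs. {(vs @ [hd vs]) ! i, (vs @ [hd vs]) ! Suc i} \<in> E)"
    by (simp add: successively_conv_nth)
  also have "\<dots> \<longleftrightarrow> (\<forall>i < length vs. {vs ! i, vs ! (Suc i mod length vs)} \<in> E)"
    using nth by simp
  also have "\<dots> \<longleftrightarrow> cycle_edges vs \<subseteq> E"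
    by (auto simp: cycle_edges_def)
  finally show ?thesis .
qed

lemma even_simple_cycle_coboundary:
  assumes "simple_graph \<Delta>" "b \<subseteq> verts \<Delta>" "simple_cycle \<Delta> vs"
  shows "even (card (cycle_edges vs \<inter> coboundary \<Delta> b))"
proof -
  have vs: "3 \<le> length vs" "distinct vs" "vs \<noteq> []" "cycle_edges vs \<subseteq> edges \<Delta>"
    using assms(3) by (auto simp: simple_cycle_def)
  have "\<not> walk_parity (coboundary \<Delta> b) (vs @ [hd vs])"
    using walk_parity_coboundary[OF assms(1,2)] successively_cycle_iff[OF vs(3)] vs by simp
  then show ?thesis using walk_parity_cycle[OF vs(1,2)] by blast
qed

text \<open>Induction on the length. A repeated vertex other than the common endpoint splits the
  walk into two shorter closed walks whose parities add. Without such a repetition the walk is a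
  simple cycle or degenerate.\<close>

lemma closed_walk_even:
  assumes "simple_graph \<Delta>" "\<And>vs. simple_cycle \<Delta> vs \<Longrightarrow> even (card (cycle_edges vs \<inter> F))"
  shows "successively (\<lambda>x y. {x, y} \<in> edges \<Delta>) xs \<Longrightarrow> xs \<noteq> [] \<Longrightarrow> hd xs = last xs \<Longrightarrow> \<not> walk_parity F xs"
proof (induction xs rule: length_induct)
  case (1 xs)
  define vs where "vs = butlast xs"
  have xs: "xs = vs @ [last xs]" using 1 by (simp add: vs_def)
  have walk: "successively (\<lambda>x y. {x, y} \<in> edges \<Delta>) (vs @ [last xs])" using 1 xs by metis
  show ?case
  proof (cases "distinct vs")
    case True
    \<comment> \<open>The degenerate walks: a single vertex, a loop, which a simple graph excludes,
      and one edge traversed back and forth.\<close>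
    consider "vs = []" | a where "vs = [a]" | a b where "vs = [a, b]" | "3 \<le> length vs"
      by (metis One_nat_def Suc_le_eq length_0_conv length_Cons not_less_eq_eq numeral_3_eq_3
          le_zero_eq neq_Nil_conv)
    then show ?thesis
    proof cases
      case 1
      then show ?thesis by (metis append_Nil walk_parity.simps(3) xs)
    next
      case (2 a)
      then have "last xs = a" using \<open>hd xs = last xs\<close> xs by (metis append_Cons list.sel(1))
      then have "{a} \<in> edges \<Delta>" using walk 2 by simp
      then show ?thesis using assms(1) by (force simp: simple_graph_def)
    next
      case (3 a b)
      then have "last xs = a" using \<open>hd xs = last xs\<close> xs by (metis append_Cons list.sel(1))
      then have "xs = [a, b, a]" using xs 3 by simp
      then show ?thesis by (simp add: insert_commute)
    next
      case 4
      then have hd: "last xs = hd vs" using \<open>hd xs = last xs\<close> xs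
        by (metis hd_append2 list.size(3) not_numeral_le_zero)
      have "vs \<noteq> []" using 4 by auto
      then have "simple_cycle \<Delta> vs"
        using walk True 4 successively_cycle_iff unfolding hd simple_cycle_def by blast
      then show ?thesis
        using assms(2) walk_parity_cycle[OF 4 True] xs hd by metis
    qed
  next
    case False
    then obtain as v bs cs where "vs = as @ [v] @ bs @ [v] @ cs" using not_distinct_decomp by blast
    then have eq: "xs = as @ [v] @ bs @ [v] @ cs @ [last xs]" using xs by simp
    let ?l = "last xs"
    let ?inner = "v # bs @ [v]" and ?outer = "as @ v # cs @ [?l]"
    have w: "successively (\<lambda>x y. {x, y} \<in> edges \<Delta>) (as @ [v] @ bs @ [v] @ cs @ [?l])"
      using 1(2) eq by metis
    have "successively (\<lambda>x y. {x, y} \<in> edges \<Delta>) ?inner" "successively (\<lambda>x y. {x, y} \<in> edges \<Delta>) ?outer"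
      using w by (auto simp: successively_append_iff successively_Cons hd_append split: if_splits)
    moreover have "length ?inner < length xs" "length ?outer < length xs" by (subst eq, simp)+
    moreover have "hd ?outer = last ?outer"
      using \<open>hd xs = last xs\<close> eq by (metis append_Cons append_Nil append_is_Nil_conv hd_append2 last_snoc list.sel(1) append_assoc)
    ultimately have p: "\<not> walk_parity F ?inner" "\<not> walk_parity F ?outer" using 1(1) by auto
    have "walk_parity F (as @ [v] @ bs @ [v] @ cs @ [?l]) = (walk_parity F ?inner \<noteq> walk_parity F ?outer)"
      using walk_parity_split[of F as v "bs @ [v] @ cs @ [?l]"] walk_parity_split[of F "v # bs" v "cs @ [?l]"]
        walk_parity_split[of F as v "cs @ [?l]"] by auto
    then show ?thesis using p eq by metis
  qed
qed

lemma connection_walk: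
  assumes "(u, v) \<in> connection \<Delta>"
  shows "\<exists>xs. xs \<noteq> [] \<and> hd xs = u \<and> last xs = v \<and> successively (\<lambda>x y. {x, y} \<in> edges \<Delta>) xs"
proof -
  have "(u, v) \<in> {(x, y). {x, y} \<in> edges \<Delta>}\<^sup>*" using assms by (simp add: connection_def)
  then show ?thesis
  proof (induction rule: rtrancl_induct)
    case base
    then show ?case by (intro exI[of _ "[u]"]) simp
  next
    case (step y z)
    then obtain xs where "xs \<noteq> []" "hd xs = u" "last xs = y" "successively (\<lambda>x y. {x, y} \<in> edges \<Delta>) xs"
      by blast
    then show ?case using step(2) by (intro exI[of _ "xs @ [z]"]) (auto simp: successively_append_iff)
  qed
qed

text \<open>A potential: fix a root, choose a walk to every vertex, and let \<open>b\<close> consist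
  of the vertices whose walk uses \<open>F\<close> an odd number of times. For an edge
  \<open>uv\<close>, the walk to \<open>u\<close>, the edge, and the reversed walk to
  \<open>v\<close> close up, so the parities at \<open>u\<close> and \<open>v\<close> differ exactly
  when the edge is in \<open>F\<close>.\<close>

lemma even_on_cycles_coboundary:
  assumes "simple_graph \<Delta>" "connected_graph \<Delta>" "F \<subseteq> edges \<Delta>"
    "\<And>vs. simple_cycle \<Delta> vs \<Longrightarrow> even (card (cycle_edges vs \<inter> F))"
  shows "\<exists>b \<subseteq> verts \<Delta>. coboundary \<Delta> b = F"
proof (cases "verts \<Delta> = {}")
  case True
  then have "edges \<Delta> = {}" using simple_graph_edgeE[OF assms(1)] by (metis all_not_in_conv)
  then show ?thesis using assms(3) by (intro exI[of _ "{}"]) (simp add: coboundary_def)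
next
  case False
  then obtain r where r: "r \<in> verts \<Delta>" by blast
  let ?walk = "successively (\<lambda>x y. {x, y} \<in> edges \<Delta>)"
  have "\<forall>v \<in> verts \<Delta>. \<exists>xs. xs \<noteq> [] \<and> hd xs = r \<and> last xs = v \<and> ?walk xs"
    using connection_walk assms(2) r by (metis connected_graph_def)
  then obtain W where W: "\<And>v. v \<in> verts \<Delta> \<Longrightarrow> W v \<noteq> [] \<and> hd (W v) = r \<and> last (W v) = v \<and> ?walk (W v)"
    by metis
  define b where "b = {v \<in> verts \<Delta>. walk_parity F (W v)}"
  have b: "b \<subseteq> verts \<Delta>" by (auto simp: b_def)
  have "e \<in> coboundary \<Delta> b \<longleftrightarrow> e \<in> F" if e: "e \<in> edges \<Delta>" for e
  proof -
    obtain u v where uv: "e = {u, v}" "u \<in> verts \<Delta>" "v \<in> verts \<Delta>"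
      using simple_graph_edgeE[OF assms(1) e] by metis
    let ?xs = "W u @ rev (W v)"
    have "?walk (rev (W v))" using W[OF uv(3)] by (simp add: successively_rev insert_commute)
    then have "?walk ?xs" using W[OF uv(2)] W[OF uv(3)] e uv(1)
      by (auto simp: successively_append_iff hd_rev)
    then have "\<not> walk_parity F ?xs"
      using W[OF uv(2)] W[OF uv(3)] by (intro closed_walk_even[OF assms(1,4)]) (auto simp: last_rev)
    then have "walk_parity F (W u) \<noteq> walk_parity F (W v) \<longleftrightarrow> {u, v} \<in> F"
      using W[OF uv(2)] W[OF uv(3)] by (auto simp: walk_parity_append walk_parity_rev hd_rev)
    then show ?thesis
      using coboundary_pair[OF assms(1) b, of u v] e uv unfolding b_def by auto
  qed
  then have "coboundary \<Delta> b = F" using assms(3) coboundary_subset_edges[of \<Delta> b] by blast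
  then show ?thesis using b by blast
qed

section \<open>Elements of the edge group as edge sets, and parity on the closure\<close>

definition edge_support :: "'v ugraph \<Rightarrow> ('v set \<Rightarrow> int) \<Rightarrow> 'v set set" where
  "edge_support \<Delta> f = {e \<in> edges \<Delta>. f e \<noteq> 0}"

lemma even_card_sym_diff:
  assumes "finite A" "finite B"
  shows "even (card (sym_diff A B)) \<longleftrightarrow> (even (card A) \<longleftrightarrow> even (card B))"
proof -
  have "card A = card (A - B) + card (A \<inter> B)" "card B = card (B - A) + card (A \<inter> B)"
    using assms by (simp_all add: card_Diff_subset_Int Int_commute card_mono)
  moreover have "card (sym_diff A B) = card (A - B) + card (B - A)"
    using assms by (intro card_Un_disjoint) auto
  ultimately show ?thesis by presburger
qed

lemma carrier_edge_group: "carrier (edge_group \<Delta>) = edges \<Delta> \<rightarrow>\<^sub>E {0, 1}"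
proof -
  have "carrier (integer_mod_group 2) = {0, 1}" by (auto simp: carrier_integer_mod_group)
  then show ?thesis by (simp add: edge_group_def)
qed

lemma group_edge_group: "group (edge_group \<Delta>)"
  unfolding edge_group_def by (intro product_group) simp

lemma edge_support_one: "edge_support \<Delta> \<one>\<^bsub>edge_group \<Delta>\<^esub> = {}"
  by (auto simp: edge_support_def edge_group_def)

lemma edge_support_mult:
  assumes "f \<in> carrier (edge_group \<Delta>)" "g \<in> carrier (edge_group \<Delta>)"
  shows "edge_support \<Delta> (f \<otimes>\<^bsub>edge_group \<Delta>\<^esub> g) = sym_diff (edge_support \<Delta> f) (edge_support \<Delta> g)"
proof -
  have "(f \<otimes>\<^bsub>edge_group \<Delta>\<^esub> g) e = (f e + g e) mod 2" if "e \<in> edges \<Delta>" for e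
    using that by (simp add: edge_group_def mult_integer_mod_group)
  moreover have "f e \<in> {0, 1}" "g e \<in> {0, 1}" if "e \<in> edges \<Delta>" for e
    using that assms by (auto simp: carrier_edge_group PiE_iff)
  ultimately show ?thesis by (fastforce simp: edge_support_def)
qed

lemma edge_support_inv:
  assumes "f \<in> carrier (edge_group \<Delta>)"
  shows "edge_support \<Delta> (inv\<^bsub>edge_group \<Delta>\<^esub> f) = edge_support \<Delta> f"
proof -
  interpret group "edge_group \<Delta>" by (rule group_edge_group)
  have "sym_diff (edge_support \<Delta> f) (edge_support \<Delta> (inv\<^bsub>edge_group \<Delta>\<^esub> f)) = {}"
    using edge_support_mult[OF assms inv_closed[OF assms]] assms by (simp add: edge_support_one)
  then show ?thesis by blast
qed

text \<open>For fixed \<open>D\<close>, the functions of finite support meeting \<open>D\<close>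
  evenly form a subgroup, since addition becomes symmetric difference of supports.\<close>

lemma generate_even_support:
  assumes "f \<in> generate (edge_group \<Delta>) S"
    "\<And>s. s \<in> S \<Longrightarrow> s \<in> carrier (edge_group \<Delta>) \<and> finite (edge_support \<Delta> s) \<and> even (card (edge_support \<Delta> s \<inter> D))"
  shows "f \<in> carrier (edge_group \<Delta>) \<and> finite (edge_support \<Delta> f) \<and> even (card (edge_support \<Delta> f \<inter> D))"
  using assms(1)
proof (induction rule: generate.induct)
  interpret group "edge_group \<Delta>" by (rule group_edge_group)
  {
    case one
    then show ?case by (simp add: edge_support_one)
  next
    case (incl h)
    then show ?case using assms(2) by blast
  next
    case (inv h)
    then show ?case using assms(2)[OF inv] edge_support_inv[of h \<Delta>] by simp
  next
    case (eng f g)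
    have "sym_diff (edge_support \<Delta> f) (edge_support \<Delta> g) \<inter> D =
        sym_diff (edge_support \<Delta> f \<inter> D) (edge_support \<Delta> g \<inter> D)" by blast
    then show ?case
      using eng even_card_sym_diff[of "edge_support \<Delta> f \<inter> D" "edge_support \<Delta> g \<inter> D"]
        edge_support_mult[of f \<Delta> g] by simp
  }
qed

lemma edge_support_indicator: "F \<subseteq> edges \<Delta> \<Longrightarrow> edge_support \<Delta> (edge_indicator \<Delta> F) = F"
  by (auto simp: edge_support_def edge_indicator_def)

lemma finite_cycle_edges: "finite (cycle_edges vs)"
  unfolding cycle_edges_def by (rule finite_image_set) simp

lemma cycle_space_support:
  assumes "simple_graph \<Delta>" "f \<in> cycle_space \<Delta>" "b \<subseteq> verts \<Delta>"
  shows "f \<in> carrier (edge_group \<Delta>)" "finite (edge_support \<Delta> f)"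
    "even (card (edge_support \<Delta> f \<inter> coboundary \<Delta> b))"
proof -
  have "f \<in> carrier (edge_group \<Delta>) \<and> finite (edge_support \<Delta> f) \<and>
      even (card (edge_support \<Delta> f \<inter> coboundary \<Delta> b))"
    using assms(2) unfolding cycle_space_def
  proof (rule generate_even_support)
    fix s assume "s \<in> {edge_indicator \<Delta> (cycle_edges vs) | vs. simple_cycle \<Delta> vs}"
    then obtain vs where vs: "s = edge_indicator \<Delta> (cycle_edges vs)" "simple_cycle \<Delta> vs" by blast
    then have "edge_support \<Delta> s = cycle_edges vs"
      by (simp add: edge_support_indicator simple_cycle_def)
    then show "s \<in> carrier (edge_group \<Delta>) \<and> finite (edge_support \<Delta> s) \<and>
        even (card (edge_support \<Delta> s \<inter> coboundary \<Delta> b))"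
      using even_simple_cycle_coboundary[OF assms(1,3) vs(2)] finite_cycle_edges vs(1)
      by (auto simp: carrier_edge_group edge_indicator_def)
  qed
  then show "f \<in> carrier (edge_group \<Delta>)" "finite (edge_support \<Delta> f)"
    "even (card (edge_support \<Delta> f \<inter> coboundary \<Delta> b))" by blast+
qed

text \<open>Prescribing finitely many coordinates is an open condition in a product of discrete
  spaces, so the resulting neighbourhood \<open>?U\<close> of \<open>f\<close> meets
  \<open>T\<close>.\<close>

lemma closure_agrees_on_finite:
  assumes "f \<in> (edge_topology \<Delta>) closure_of T" "finite F" "F \<subseteq> edges \<Delta>"
  shows "\<exists>g \<in> T. edge_support \<Delta> g \<inter> F = edge_support \<Delta> f \<inter> F"
proof -
  let ?C = "carrier (integer_mod_group 2)"
  have f: "f \<in> (\<Pi>\<^sub>E e \<in> edges \<Delta>. ?C)"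
    using assms(1) by (auto simp: closure_of_def edge_topology_def)
  let ?U = "\<Pi>\<^sub>E e \<in> edges \<Delta>. if e \<in> F then {f e} else ?C"
  have "openin (edge_topology \<Delta>) ?U"
    unfolding edge_topology_def openin_PiE_gen
  proof (intro disjI2 conjI ballI)
    show "finite {e \<in> edges \<Delta>. (if e \<in> F then {f e} else ?C) \<noteq> topspace (discrete_topology ?C)}"
      by (rule finite_subset[OF _ assms(2)]) auto
    show "openin (discrete_topology ?C) (if e \<in> F then {f e} else ?C)" if "e \<in> edges \<Delta>" for e
      using f that by (auto simp: PiE_iff)
  qed
  moreover have "f \<in> ?U" using f by (auto simp: PiE_iff)
  ultimately obtain g where "g \<in> T" "g \<in> ?U" using assms(1) unfolding closure_of_def by blast
  moreover from this have "g e = f e" if "e \<in> F" for e using that assms(3) by (force simp: PiE_iff)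
  ultimately show ?thesis by (intro bexI[of _ g]) (auto simp: edge_support_def)
qed

text \<open>On the finite set \<open>F\<close> a simple cycle coincides with an element of the group
  generated by \<open>S\<close>, so parity on the generators forces parity on all cycles. This is
  where generation up to closure enters.\<close>

lemma topological_generators_detect_coboundaries:
  assumes "simple_graph \<Delta>" "connected_graph \<Delta>" "topological_generating_set \<Delta> S"
    "F \<subseteq> edges \<Delta>" "finite F" "\<And>s. s \<in> S \<Longrightarrow> even (card (edge_support \<Delta> s \<inter> F))"
  shows "\<exists>b \<subseteq> verts \<Delta>. coboundary \<Delta> b = F"
proof (rule even_on_cycles_coboundary[OF assms(1,2,4)])
  fix vs assume vs: "simple_cycle \<Delta> vs"
  let ?f = "edge_indicator \<Delta> (cycle_edges vs)"
  have "?f \<in> cycle_space \<Delta>" unfolding cycle_space_def using vs by (intro generate.incl) blast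
  then have "?f \<in> (edge_topology \<Delta>) closure_of (generate (edge_group \<Delta>) S)"
    using assms(3) by (auto simp: topological_generating_set_def)
  from closure_agrees_on_finite[OF this assms(5,4)] obtain g
    where g: "g \<in> generate (edge_group \<Delta>) S" "edge_support \<Delta> g \<inter> F = edge_support \<Delta> ?f \<inter> F" by blast
  have S: "S \<subseteq> cycle_space \<Delta>" using assms(3) by (simp add: topological_generating_set_def)
  have "even (card (edge_support \<Delta> g \<inter> F))"
    using generate_even_support[OF g(1), of F] cycle_space_support(1,2)[OF assms(1), of _ "{}"] S assms(6)
    by blast
  moreover have "edge_support \<Delta> ?f = cycle_edges vs"
    using vs by (simp add: edge_support_indicator simple_cycle_def)
  ultimately show "even (card (cycle_edges vs \<inter> F))" using g(2) by simp
qed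

section \<open>Balls in the ground graph\<close>

fun graph_ball :: "'v ugraph \<Rightarrow> nat \<Rightarrow> 'v \<Rightarrow> 'v set" where
  "graph_ball \<Gamma> 0 u = {u}"
| "graph_ball \<Gamma> (Suc n) u = graph_ball \<Gamma> n u \<union> {w. \<exists>v \<in> graph_ball \<Gamma> n u. {v, w} \<in> edges \<Gamma>}"

lemma graph_ball_verts: "simple_graph \<Gamma> \<Longrightarrow> u \<in> verts \<Gamma> \<Longrightarrow> graph_ball \<Gamma> n u \<subseteq> verts \<Gamma>"
  by (induction n) (auto simp: simple_graph_def)

lemma graph_ball_finite:
  assumes "simple_graph \<Gamma>" "locally_finite_graph \<Gamma>" "u \<in> verts \<Gamma>"
  shows "finite (graph_ball \<Gamma> n u)"
proof (induction n)
  case (Suc n)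
  have "finite {w. {v, w} \<in> edges \<Gamma>}" if "v \<in> graph_ball \<Gamma> n u" for v
  proof (rule finite_subset)
    show "{w. {v, w} \<in> edges \<Gamma>} \<subseteq> \<Union>{e \<in> edges \<Gamma>. v \<in> e}" by blast
    have "v \<in> verts \<Gamma>" using graph_ball_verts[OF assms(1,3)] that by blast
    then have "finite {e \<in> edges \<Gamma>. v \<in> e}" using assms(2) by (simp add: locally_finite_graph_def)
    moreover have "finite e" if "e \<in> edges \<Gamma>" for e
      using simple_graph_edgeE[OF assms(1) that] by (metis finite.emptyI finite_insert)
    ultimately show "finite (\<Union>{e \<in> edges \<Gamma>. v \<in> e})" by (intro finite_Union) auto
  qed
  moreover have "{w. \<exists>v \<in> graph_ball \<Gamma> n u. {v, w} \<in> edges \<Gamma>} = (\<Union>v \<in> graph_ball \<Gamma> n u. {w. {v, w} \<in> edges \<Gamma>})"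
    by blast
  ultimately show ?case using Suc by simp
qed simp

lemma graph_ball_mono: "m \<le> n \<Longrightarrow> graph_ball \<Gamma> m u \<subseteq> graph_ball \<Gamma> n u"
  by (induction n) (auto simp: le_Suc_eq)

lemma graph_ball_step: "{u, v} \<in> edges \<Gamma> \<Longrightarrow> w \<in> graph_ball \<Gamma> n v \<Longrightarrow> w \<in> graph_ball \<Gamma> (Suc n) u"
  by (induction n arbitrary: w) auto

lemma graph_ball_sym: "w \<in> graph_ball \<Gamma> n u \<Longrightarrow> u \<in> graph_ball \<Gamma> n w"
proof (induction n arbitrary: w)
  case (Suc n)
  then consider "w \<in> graph_ball \<Gamma> n u" | v where "v \<in> graph_ball \<Gamma> n u" "{v, w} \<in> edges \<Gamma>" by auto
  then show ?case
  proof cases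
    case 1
    then show ?thesis using Suc.IH by simp
  next
    case 2
    then have "{w, v} \<in> edges \<Gamma>" by (simp add: insert_commute)
    then show ?thesis using graph_ball_step[OF _ Suc.IH[OF 2(1)]] by blast
  qed
qed simp

lemma graph_ball_exhausts:
  assumes "connected_graph \<Gamma>" "u \<in> verts \<Gamma>" "v \<in> verts \<Gamma>"
  shows "\<exists>n. v \<in> graph_ball \<Gamma> n u"
proof -
  have "(u, v) \<in> {(x, y). {x, y} \<in> edges \<Gamma>}\<^sup>*"
    using assms by (auto simp: connected_graph_def connection_def)
  then show ?thesis
  proof (induction rule: rtrancl_induct)
    case base
    show ?case by (intro exI[of _ 0]) simp
  next
    case (step y z)
    then obtain n where "y \<in> graph_ball \<Gamma> n u" by blast
    then show ?case using step(2) by (intro exI[of _ "Suc n"]) auto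
  qed
qed

lemma graph_ball_crosses_coboundary:
  assumes "simple_graph \<Gamma>" "b \<subseteq> verts \<Gamma>"
  shows "w \<in> graph_ball \<Gamma> n u \<Longrightarrow> (u \<in> b) \<noteq> (w \<in> b) \<Longrightarrow> \<exists>z \<in> \<Union>(coboundary \<Gamma> b). z \<in> graph_ball \<Gamma> n u"
proof (induction n arbitrary: w)
  case (Suc n)
  then consider "w \<in> graph_ball \<Gamma> n u" | v where "v \<in> graph_ball \<Gamma> n u" "{v, w} \<in> edges \<Gamma>" by auto
  then show ?case
  proof cases
    case 1
    then show ?thesis using Suc.IH Suc.prems by auto
  next
    case 2
    show ?thesis
    proof (cases "(u \<in> b) \<noteq> (v \<in> b)")
      case True
      then show ?thesis using Suc.IH[OF 2(1)] by auto
    next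
      case False
      then have "{v, w} \<in> coboundary \<Gamma> b"
        using coboundary_pair[OF assms 2(2)] Suc.prems by blast
      moreover have "v \<in> graph_ball \<Gamma> (Suc n) u" using 2(1) by simp
      ultimately show ?thesis by blast
    qed
  qed
qed simp

section \<open>The action on the cone-off\<close>

lemma edges_cone_off: "edges (cone_off \<Gamma> (\<H> - {{}})) = edges (cone_off \<Gamma> \<H>)"
  by (auto simp: cone_off_def)

text \<open>All these notions are built from the edge set alone. The generating set thus passes to
  the cone-off without the isolated vertex over the empty peripheral set, a graph which is
  connected.\<close>

lemma topological_generating_set_cong:
  assumes "edges \<Delta> = edges \<Delta>'"
  shows "topological_generating_set \<Delta> S \<longleftrightarrow> topological_generating_set \<Delta>' S"
  unfolding topological_generating_set_def cycle_space_def simple_cycle_def edge_group_def edge_topology_def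
    edge_indicator_def using assms by simp

text \<open>The empty peripheral set is dropped from the cone-off, where it is an isolated vertex.\<close>

locale cone_generators =
  fixes G :: "('g, 'm) monoid_scheme" and \<Gamma> :: "'v ugraph" and \<phi> :: "'g \<Rightarrow> 'v \<Rightarrow> 'v"
    and \<H> :: "'v set set" and S :: "(('v + 'v set) set \<Rightarrow> int) set"
  assumes group: "group G"
    and G_graph: "G_graph G \<Gamma> \<phi>"
    and connected: "connected_graph \<Gamma>"
    and locally_finite: "locally_finite_graph \<Gamma>"
    and peripheral: "peripheral_system \<Gamma> \<H>"
    and invariant: "invariant_system G \<phi> \<H>"
    and thin: "thin \<Gamma> \<H>"
    and generating: "topological_generating_set (cone_off \<Gamma> \<H>) S"
    and S_invariant: "g \<in> carrier G \<Longrightarrow> f \<in> S \<Longrightarrow>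
      edge_action G (cone_off \<Gamma> \<H>) (cone_action \<Gamma> \<H> \<phi>) g f \<in> S"
    and S_orbits: "finite (orbits G S (edge_action G (cone_off \<Gamma> \<H>) (cone_action \<Gamma> \<H> \<phi>)))"
begin

abbreviation "\<Delta> \<equiv> cone_off \<Gamma> (\<H> - {{}})"
abbreviation "act \<equiv> cone_action \<Gamma> \<H> \<phi>"
abbreviation "eact \<equiv> edge_action G (cone_off \<Gamma> \<H>) (cone_action \<Gamma> \<H> \<phi>)"

lemma simple_ground: "simple_graph \<Gamma>"
  and action: "group_action G (verts \<Gamma>) \<phi>"
  using G_graph by (auto simp: G_graph_def)

lemma verts_cone: "verts \<Delta> = verts \<Gamma> <+> (\<H> - {{}})"
  by (simp add: cone_off_def)

lemma edges_coneE:
  assumes "e \<in> edges \<Delta>"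
  obtains u v where "e = {Inl u, Inl v}" "{u, v} \<in> edges \<Gamma>" "u \<in> verts \<Gamma>" "v \<in> verts \<Gamma>" "u \<noteq> v"
  | u H where "e = {Inl u, Inr H}" "H \<in> \<H>" "u \<in> H" "u \<in> verts \<Gamma>"
proof -
  consider f where "e = Inl ` f" "f \<in> edges \<Gamma>" | u H where "e = {Inl u, Inr H}" "H \<in> \<H>" "u \<in> H"
    using assms by (auto simp: cone_off_def)
  then show ?thesis
  proof cases
    case 1
    then obtain u v where "f = {u, v}" "u \<noteq> v" "u \<in> verts \<Gamma>" "v \<in> verts \<Gamma>"
      using simple_graph_edgeE[OF simple_ground] by metis
    then show ?thesis using that(1)[of u v] 1 by simp
  next
    case 2
    then show ?thesis using that(2)[of u H] peripheral by (auto simp: peripheral_system_def)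
  qed
qed

lemma edge_coneI:
  "{u, v} \<in> edges \<Gamma> \<Longrightarrow> {Inl u, Inl v} \<in> edges \<Delta>"
  "H \<in> \<H> \<Longrightarrow> u \<in> H \<Longrightarrow> {Inl u, Inr H} \<in> edges \<Delta>"
proof -
  assume "{u, v} \<in> edges \<Gamma>"
  moreover have "{Inl u, Inl v} = Inl ` {u, v}" by simp
  ultimately show "{Inl u, Inl v} \<in> edges \<Delta>" unfolding cone_off_def by auto
qed (auto simp: cone_off_def)

lemma simple_cone: "simple_graph \<Delta>"
  unfolding simple_graph_def
proof
  fix e assume "e \<in> edges \<Delta>"
  then show "e \<subseteq> verts \<Delta> \<and> card e = 2"
    by (cases rule: edges_coneE) (auto simp: verts_cone)
qed

lemma connected_cone: "connected_graph \<Delta>"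
proof -
  let ?r = "{(x, y). {x, y} \<in> edges \<Delta>}"
  have sym: "sym ?r" by (auto simp: sym_def insert_commute)
  have ground: "(Inl u, Inl v) \<in> ?r\<^sup>*" if "u \<in> verts \<Gamma>" "v \<in> verts \<Gamma>" for u v
  proof -
    have "(u, v) \<in> {(x, y). {x, y} \<in> edges \<Gamma>}\<^sup>*"
      using connected that by (auto simp: connected_graph_def connection_def)
    then show ?thesis
    proof (induction rule: rtrancl_induct)
      case (step y z)
      then have "(Inl y, Inl z) \<in> ?r" using edge_coneI(1) by simp
      then show ?case using step.IH by (rule rtrancl_into_rtrancl[rotated])
    qed simp
  qed
  have base: "\<exists>u \<in> verts \<Gamma>. (Inl u, x) \<in> ?r\<^sup>*" if x: "x \<in> verts \<Delta>" for x
  proof (cases x)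
    case (Inl u)
    then show ?thesis using x by (auto simp: verts_cone)
  next
    \<comment> \<open>Nonemptiness of \<open>H\<close> supplies a ground neighbour of its cone
      vertex.\<close>
    case (Inr H)
    then obtain u where "H \<in> \<H>" "u \<in> H" using x by (auto simp: verts_cone)
    then have "u \<in> verts \<Gamma>" "(Inl u, x) \<in> ?r"
      using peripheral edge_coneI(2) Inr by (auto simp: peripheral_system_def)
    then show ?thesis by blast
  qed
  have "(x, y) \<in> ?r\<^sup>*" if xy: "x \<in> verts \<Delta>" "y \<in> verts \<Delta>" for x y
  proof -
    obtain u v where u: "u \<in> verts \<Gamma>" "(Inl u, x) \<in> ?r\<^sup>*" and v: "v \<in> verts \<Gamma>" "(Inl v, y) \<in> ?r\<^sup>*"
      using base[OF xy(1)] base[OF xy(2)] by blast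
    have "(x, Inl u) \<in> ?r\<^sup>*" using u(2) sym_rtrancl[OF sym] by (rule symD[rotated])
    then show ?thesis using ground[OF u(1) v(1)] v(2) by (meson rtrancl_trans)
  qed
  then show ?thesis by (simp add: connected_graph_def connection_def)
qed

lemma phi_verts: "g \<in> carrier G \<Longrightarrow> v \<in> verts \<Gamma> \<Longrightarrow> \<phi> g v \<in> verts \<Gamma>"
  using group_action.element_image[OF action] by blast

lemma phi_inv:
  assumes "g \<in> carrier G" "v \<in> verts \<Gamma>"
  shows "\<phi> (inv\<^bsub>G\<^esub> g) (\<phi> g v) = v" "\<phi> g (\<phi> (inv\<^bsub>G\<^esub> g) v) = v"
proof -
  show 1: "\<phi> (inv\<^bsub>G\<^esub> g) (\<phi> g v) = v"
    using group_action.orbit_sym_aux[OF action assms refl] .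
  have inv: "inv\<^bsub>G\<^esub> g \<in> carrier G" using group.inv_closed[OF group assms(1)] .
  show "\<phi> g (\<phi> (inv\<^bsub>G\<^esub> g) v) = v"
    using group_action.orbit_sym_aux[OF action inv assms(2) refl] group.inv_inv[OF group assms(1)] by simp
qed

lemma act_Inl: "v \<in> verts \<Gamma> \<Longrightarrow> act g (Inl v) = Inl (\<phi> g v)"
  and act_Inr: "H \<in> \<H> \<Longrightarrow> act g (Inr H) = Inr (\<phi> g ` H)"
  by (simp_all add: cone_action_def InlI InrI)

lemma peripheral_verts: "H \<in> \<H> \<Longrightarrow> H \<subseteq> verts \<Gamma>"
  using peripheral by (auto simp: peripheral_system_def)

lemma phi_peripheral: "g \<in> carrier G \<Longrightarrow> H \<in> \<H> \<Longrightarrow> \<phi> g ` H \<in> \<H>"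
  using invariant by (auto simp: invariant_system_def)

lemma act_verts:
  assumes "g \<in> carrier G" "x \<in> verts \<Delta>"
  shows "act g x \<in> verts \<Delta>"
  using assms(2) phi_verts[OF assms(1)] phi_peripheral[OF assms(1)]
  by (cases x) (auto simp: verts_cone act_Inl act_Inr)

lemma act_inv:
  assumes "g \<in> carrier G" "x \<in> verts \<Delta>"
  shows "act (inv\<^bsub>G\<^esub> g) (act g x) = x" "act g (act (inv\<^bsub>G\<^esub> g) x) = x"
proof -
  have inv: "inv\<^bsub>G\<^esub> g \<in> carrier G" using group.inv_closed[OF group assms(1)] .
  have im: "\<phi> (inv\<^bsub>G\<^esub> g) ` \<phi> g ` H = H" "\<phi> g ` \<phi> (inv\<^bsub>G\<^esub> g) ` H = H" if "H \<in> \<H>" for H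
    using peripheral_verts[OF that] phi_inv[OF assms(1)]
    by (simp_all add: image_image subset_iff cong: image_cong_simp)
  show "act (inv\<^bsub>G\<^esub> g) (act g x) = x" "act g (act (inv\<^bsub>G\<^esub> g) x) = x"
    using assms(2) phi_verts[OF assms(1)] phi_verts[OF inv] phi_inv[OF assms(1)] im
      phi_peripheral[OF assms(1)] phi_peripheral[OF inv]
    by (cases x; auto simp: verts_cone act_Inl act_Inr)+
qed

lemma act_image_inv:
  assumes "g \<in> carrier G" "e \<subseteq> verts \<Delta>"
  shows "act (inv\<^bsub>G\<^esub> g) ` act g ` e = e" "act g ` act (inv\<^bsub>G\<^esub> g) ` e = e"
  using assms(2) act_inv[OF assms(1)] by (simp_all add: image_image subset_iff cong: image_cong_simp)

lemma phi_edge: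
  assumes "g \<in> carrier G" "{u, v} \<in> edges \<Gamma>"
  shows "{\<phi> g u, \<phi> g v} \<in> edges \<Gamma>"
proof -
  have "u \<in> verts \<Gamma>" "v \<in> verts \<Gamma>" using simple_ground assms(2) by (auto simp: simple_graph_def)
  then show ?thesis using G_graph assms by (simp add: G_graph_def)
qed

lemma act_edge:
  assumes "g \<in> carrier G" "e \<in> edges \<Delta>"
  shows "act g ` e \<in> edges \<Delta>"
  using assms(2)
proof (cases rule: edges_coneE)
  case (1 u v)
  then show ?thesis using edge_coneI(1)[OF phi_edge[OF assms(1) 1(2)]] by (simp add: act_Inl)
next
  case (2 u H)
  then show ?thesis using edge_coneI(2)[OF phi_peripheral[OF assms(1) 2(2)], of "\<phi> g u"]
    by (simp add: act_Inl act_Inr)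
qed

lemma act_edge_iff:
  assumes "g \<in> carrier G" "e \<subseteq> verts \<Delta>"
  shows "act g ` e \<in> edges \<Delta> \<longleftrightarrow> e \<in> edges \<Delta>"
  using act_edge[OF assms(1), of e] act_edge[OF group.inv_closed[OF group assms(1)], of "act g ` e"]
    act_image_inv(1)[OF assms] by auto

lemma act_bij: "g \<in> carrier G \<Longrightarrow> bij_betw (act g) (verts \<Delta>) (verts \<Delta>)"
  using act_inv act_verts group.inv_closed[OF group]
  by (intro bij_betw_byWitness[where f' = "act (inv\<^bsub>G\<^esub> g)"]) auto

lemma phi_graph_ball:
  assumes "g \<in> carrier G" "w \<in> graph_ball \<Gamma> n u"
  shows "\<phi> g w \<in> graph_ball \<Gamma> n (\<phi> g u)"
  using assms(2)
proof (induction n arbitrary: w)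
  case (Suc n)
  then show ?case using phi_edge[OF assms(1)] by auto
qed simp

section \<open>The generators as finite edge sets\<close>

definition "R = edge_support \<Delta> ` S"
definition "R\<^sub>0 = edge_support \<Delta> ` (\<lambda>X. SOME f. f \<in> X) ` orbits G S eact"

lemma generating_cone: "topological_generating_set \<Delta> S"
  using generating topological_generating_set_cong[OF edges_cone_off] by blast

lemma S_cycle_space: "S \<subseteq> cycle_space \<Delta>"
  using generating_cone by (simp add: topological_generating_set_def)

lemma edge_support_action:
  assumes "g \<in> carrier G" "f \<in> S"
  shows "edge_support \<Delta> (eact g f) = (`) (act g) ` edge_support \<Delta> f"
proof -
  have f: "f \<in> carrier (edge_group (cone_off \<Gamma> \<H>))"
    using cycle_space_support(1)[OF simple_cone, of f "{}"] S_cycle_space assms(2)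
    by (auto simp: edge_group_def edges_cone_off)
  have ev: "eact g f e = f (act (inv\<^bsub>G\<^esub> g) ` e)" if "e \<in> edges \<Delta>" for e
    using f that by (simp add: edge_action_def edges_cone_off)
  have inv: "inv\<^bsub>G\<^esub> g \<in> carrier G" using group.inv_closed[OF group assms(1)] .
  have sub: "e \<subseteq> verts \<Delta>" if "e \<in> edges \<Delta>" for e using that simple_cone by (auto simp: simple_graph_def)
  show ?thesis
  proof (intro equalityI subsetI)
    fix e assume "e \<in> edge_support \<Delta> (eact g f)"
    then have e: "e \<in> edges \<Delta>" "f (act (inv\<^bsub>G\<^esub> g) ` e) \<noteq> 0" by (auto simp: edge_support_def ev)
    then have "act (inv\<^bsub>G\<^esub> g) ` e \<in> edge_support \<Delta> f" using act_edge[OF inv] by (simp add: edge_support_def)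
    moreover have "e = act g ` act (inv\<^bsub>G\<^esub> g) ` e" using act_image_inv(2)[OF assms(1) sub[OF e(1)]] by simp
    ultimately show "e \<in> (`) (act g) ` edge_support \<Delta> f" by (rule image_eqI[rotated])
  next
    fix e assume "e \<in> (`) (act g) ` edge_support \<Delta> f"
    then obtain e' where e': "e = act g ` e'" "e' \<in> edges \<Delta>" "f e' \<noteq> 0" by (auto simp: edge_support_def)
    then show "e \<in> edge_support \<Delta> (eact g f)"
      using act_edge[OF assms(1)] act_image_inv(1)[OF assms(1) sub[OF e'(2)]] by (simp add: edge_support_def ev)
  qed
qed

lemma orbit_rep:
  assumes "X \<in> orbits G S eact"
  shows "(SOME f. f \<in> X) \<in> X" "X \<subseteq> S"
proof -
  obtain f where f: "f \<in> S" "X = orbit G eact f" using assms by (auto simp: orbits_def)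
  then have "eact \<one>\<^bsub>G\<^esub> f \<in> X" using group.is_monoid[OF group] by (auto simp: orbit_def monoid.one_closed)
  then show "(SOME f. f \<in> X) \<in> X" by (rule someI[of "\<lambda>f. f \<in> X"])
  show "X \<subseteq> S" using f S_invariant by (auto simp: orbit_def)
qed

lemma R_orbit_rep:
  assumes "Z \<in> R"
  shows "\<exists>g \<in> act ` carrier G. (`) g ` Z \<in> R\<^sub>0"
proof -
  obtain f where f: "f \<in> S" "Z = edge_support \<Delta> f" using assms by (auto simp: R_def)
  let ?X = "orbit G eact f"
  have X: "?X \<in> orbits G S eact" using f(1) by (auto simp: orbits_def)
  obtain g where g: "g \<in> carrier G" "(SOME f. f \<in> ?X) = eact g f"
    using orbit_rep(1)[OF X] unfolding orbit_def by blast
  then have "(`) (act g) ` Z = edge_support \<Delta> (SOME f. f \<in> ?X)"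
    using edge_support_action[OF g(1) f(1)] f(2) by simp
  then show ?thesis using X g(1) by (intro bexI[of _ "act g"]) (auto simp: R\<^sub>0_def)
qed

lemma R_finite_edges: "Z \<in> R \<Longrightarrow> finite Z \<and> Z \<subseteq> edges \<Delta>"
  using cycle_space_support(2)[OF simple_cone, of _ "{}"] S_cycle_space by (auto simp: R_def edge_support_def)

lemma R0_subset: "R\<^sub>0 \<subseteq> R"
  unfolding R_def R\<^sub>0_def
proof (intro image_mono image_subsetI)
  fix X assume "X \<in> orbits G S eact"
  from subsetD[OF orbit_rep(2)[OF this] orbit_rep(1)[OF this]] show "(SOME f. f \<in> X) \<in> S" .
qed

text \<open>Distances are measured in \<Gamma>, where cone vertices give no shortcuts. The ground
  vertices occurring in the representatives form a finite set \<open>P\<close>; \<open>D\<close> is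
  the maximum, over pairs from \<open>P\<close>, of radii of balls reaching from one vertex to the
  other, and translation carries the bound to every generator.\<close>

lemma R_diameter: "\<exists>D. \<forall>Z \<in> R. \<forall>x y. Inl x \<in> \<Union>Z \<longrightarrow> Inl y \<in> \<Union>Z \<longrightarrow> y \<in> graph_ball \<Gamma> D x"
proof -
  define P where "P = {x. Inl x \<in> \<Union>(\<Union>R\<^sub>0)}"
  have edge: "e \<subseteq> verts \<Delta>" "finite e" if "e \<in> edges \<Delta>" for e
  proof -
    show "e \<subseteq> verts \<Delta>" using that simple_cone by (auto simp: simple_graph_def)
    show "finite e" using simple_graph_edgeE[OF simple_cone that] by (metis finite.emptyI finite_insert)
  qed
  have R0_edges: "\<Union>R\<^sub>0 \<subseteq> edges \<Delta>"
    by (intro Union_least conjunct2[OF R_finite_edges] subsetD[OF R0_subset])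
  have "finite (\<Union>(\<Union>R\<^sub>0))"
  proof (intro finite_Union)
    show "finite R\<^sub>0" unfolding R\<^sub>0_def using S_orbits by (intro finite_imageI)
    show "finite Z" if "Z \<in> R\<^sub>0" for Z using R_finite_edges[OF subsetD[OF R0_subset that]] by (rule conjunct1)
    show "finite e" if "e \<in> \<Union>R\<^sub>0" for e using edge(2)[OF subsetD[OF R0_edges that]] .
  qed
  then have "finite (Inl -` \<Union>(\<Union>R\<^sub>0))" by (rule finite_vimageI) simp
  then have fin: "finite P" by (simp add: P_def vimage_def)
  have "x \<in> verts \<Gamma>" if x: "x \<in> P" for x
  proof -
    obtain e where e: "e \<in> \<Union>R\<^sub>0" "Inl x \<in> e" using x[unfolded P_def mem_Collect_eq] by (rule UnionE)
    have "Inl x \<in> verts \<Delta>" using edge(1)[OF subsetD[OF R0_edges e(1)]] e(2) by (rule subsetD)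
    then show ?thesis by (auto simp: verts_cone)
  qed
  then have "\<forall>p \<in> P \<times> P. \<exists>n. snd p \<in> graph_ball \<Gamma> n (fst p)"
    using graph_ball_exhausts[OF connected] by auto
  then obtain n where n: "\<And>p. p \<in> P \<times> P \<Longrightarrow> snd p \<in> graph_ball \<Gamma> (n p) (fst p)" by metis
  define D where "D = Max (n ` (P \<times> P))"
  have D: "y \<in> graph_ball \<Gamma> D x" if "x \<in> P" "y \<in> P" for x y
  proof -
    have "n (x, y) \<le> D" unfolding D_def using fin that by (intro Max_ge) auto
    then show ?thesis using n[of "(x, y)"] that graph_ball_mono[of "n (x, y)" D \<Gamma> x] by auto
  qed
  have "y \<in> graph_ball \<Gamma> D x" if Z: "Z \<in> R" and xy: "Inl x \<in> \<Union>Z" "Inl y \<in> \<Union>Z" for Z x y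
  proof -
    obtain g where g: "g \<in> carrier G" "(`) (act g) ` Z \<in> R\<^sub>0" using R_orbit_rep[OF Z] by blast
    have mem: "v \<in> verts \<Gamma> \<and> \<phi> g v \<in> P" if v: "Inl v \<in> \<Union>Z" for v
    proof -
      obtain e where e: "e \<in> Z" "Inl v \<in> e" using v by (rule UnionE)
      have v: "v \<in> verts \<Gamma>" using edge(1)[of e] e R_finite_edges[OF Z] by (auto simp: verts_cone)
      then have "Inl (\<phi> g v) \<in> act g ` e" using e(2) act_Inl by (metis image_eqI)
      moreover have "act g ` e \<in> \<Union>R\<^sub>0" using g(2) by (rule UnionI) (rule imageI[OF e(1)])
      ultimately have "Inl (\<phi> g v) \<in> \<Union>(\<Union>R\<^sub>0)" by (rule UnionI[rotated])
      then show ?thesis using v by (simp only: P_def mem_Collect_eq)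
    qed
    have inv: "inv\<^bsub>G\<^esub> g \<in> carrier G" using group.inv_closed[OF group g(1)] .
    have "\<phi> (inv\<^bsub>G\<^esub> g) (\<phi> g y) \<in> graph_ball \<Gamma> D (\<phi> (inv\<^bsub>G\<^esub> g) (\<phi> g x))"
      using mem xy D by (intro phi_graph_ball[OF inv]) blast
    then show ?thesis using mem xy phi_inv(1)[OF g(1)] by simp
  qed
  then show ?thesis by blast
qed

text \<open>Ground vertices keep finite degree in the cone-off: local finiteness bounds the ground
  edges, thinness the edges to cone vertices.\<close>

lemma finite_edges_at:
  assumes "u \<in> verts \<Gamma>"
  shows "finite {e \<in> edges \<Delta>. Inl u \<in> e}"
proof (rule finite_subset)
  show "{e \<in> edges \<Delta>. Inl u \<in> e} \<subseteq> (`) Inl ` {e \<in> edges \<Gamma>. u \<in> e} \<union> (\<lambda>H. {Inl u, Inr H}) ` {H \<in> \<H>. u \<in> H}"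
    by (auto simp: cone_off_def)
  show "finite ((`) Inl ` {e \<in> edges \<Gamma>. u \<in> e} \<union> (\<lambda>H. {Inl u, Inr H}) ` {H \<in> \<H>. u \<in> H})"
    using locally_finite thin assms by (auto simp: locally_finite_graph_def thin_def)
qed

lemma edge_Inl: "e \<in> edges \<Delta> \<Longrightarrow> \<exists>u \<in> verts \<Gamma>. Inl u \<in> e"
  by (erule edges_coneE) auto

text \<open>Every edge has a ground endpoint, so a generator through \<open>u\<close> consists of
  edges at vertices of the ball of radius \<open>D\<close> around \<open>u\<close>. These edges are
  finite in number and so are their subsets.\<close>

lemma finite_R_at:
  assumes "u \<in> verts \<Gamma>"
  shows "finite {Z \<in> R. Inl u \<in> \<Union>Z}"
proof -
  obtain D where D: "\<forall>Z \<in> R. \<forall>x y. Inl x \<in> \<Union>Z \<longrightarrow> Inl y \<in> \<Union>Z \<longrightarrow> y \<in> graph_ball \<Gamma> D x"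
    using R_diameter by (elim exE)
  let ?E = "\<Union>v \<in> graph_ball \<Gamma> D u. {e \<in> edges \<Delta>. Inl v \<in> e}"
  have "finite ?E"
    by (intro finite_UN_I finite_edges_at graph_ball_finite[OF simple_ground locally_finite assms]
        subsetD[OF graph_ball_verts[OF simple_ground assms]])
  moreover have "{Z \<in> R. Inl u \<in> \<Union>Z} \<subseteq> Pow ?E"
  proof (intro subsetI PowI)
    fix Z e assume Z: "Z \<in> {Z \<in> R. Inl u \<in> \<Union>Z}" and e: "e \<in> Z"
    have ed: "e \<in> edges \<Delta>" using Z e R_finite_edges by auto
    obtain v where v: "Inl v \<in> e" using edge_Inl[OF ed] by auto
    have "v \<in> graph_ball \<Gamma> D u" 
      using Z by (intro D[rule_format, OF _ _ UnionI[OF e v]]) simp_all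
    then show "e \<in> ?E" using ed v by (intro UN_I CollectI conjI)
  qed
  ultimately show ?thesis by (rule finite_subset[rotated, OF finite_Pow_iff[THEN iffD2]])
qed

end

section \<open>Elliptic cuts and cuts of the cone-off\<close>

lemma connected_coboundary_empty:
  assumes "simple_graph \<Delta>" "connected_graph \<Delta>" "b \<subseteq> verts \<Delta>" "coboundary \<Delta> b = {}"
  shows "b = {} \<or> b = verts \<Delta>"
proof -
  have "y \<in> b" if "x \<in> b" "y \<in> verts \<Delta>" for x y
  proof -
    have "(x, y) \<in> {(x, y). {x, y} \<in> edges \<Delta>}\<^sup>*"
      using assms(2,3) that by (auto simp: connected_graph_def connection_def)
    then show ?thesis
    proof (induction rule: rtrancl_induct)
      case (step y z)
      then show ?case using coboundary_pair[OF assms(1,3), of y z] assms(4) by auto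
    qed (rule that(1))
  qed
  then show ?thesis using assms(3) by blast
qed

lemma cut_boundary_finite:
  assumes "simple_graph \<Gamma>" "cut \<Gamma> b"
  shows "finite (\<Union>(coboundary \<Gamma> b))" "\<Union>(coboundary \<Gamma> b) \<subseteq> verts \<Gamma>"
proof -
  have "finite e" if "e \<in> coboundary \<Gamma> b" for e
    using that by (auto simp: coboundary_def)
  then show "finite (\<Union>(coboundary \<Gamma> b))" using assms(2) by (auto simp: cut_def)
  show "\<Union>(coboundary \<Gamma> b) \<subseteq> verts \<Gamma>" using assms(2) by (auto simp: cut_def coboundary_def)
qed

lemma graph_ball_Union:
  assumes "simple_graph \<Gamma>" "locally_finite_graph \<Gamma>" "finite B" "B \<subseteq> verts \<Gamma>"
  shows "finite (\<Union>z \<in> B. graph_ball \<Gamma> n z)" "(\<Union>z \<in> B. graph_ball \<Gamma> n z) \<subseteq> verts \<Gamma>"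
proof -
  show "finite (\<Union>z \<in> B. graph_ball \<Gamma> n z)"
    using assms(3) graph_ball_finite[OF assms(1,2) subsetD[OF assms(4)]] by (rule finite_UN_I)
  show "(\<Union>z \<in> B. graph_ball \<Gamma> n z) \<subseteq> verts \<Gamma>"
    using graph_ball_verts[OF assms(1) subsetD[OF assms(4)]] by (rule UN_least)
qed

context cone_generators
begin

lemma R_diameterE:
  obtains D where "\<And>Z x y. Z \<in> R \<Longrightarrow> Inl x \<in> \<Union>Z \<Longrightarrow> Inl y \<in> \<Union>Z \<Longrightarrow> y \<in> graph_ball \<Gamma> D x"
proof -
  obtain D where D: "\<forall>Z \<in> R. \<forall>x y. Inl x \<in> \<Union>Z \<longrightarrow> Inl y \<in> \<Union>Z \<longrightarrow> y \<in> graph_ball \<Gamma> D x"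
    using R_diameter by (elim exE)
  show ?thesis by (rule that, rule D[rule_format])
qed

lemma finite_R_through:
  assumes "e \<in> edges \<Delta>"
  shows "finite {Z \<in> R. e \<in> Z}"
proof -
  obtain u where u: "u \<in> verts \<Gamma>" "Inl u \<in> e" using edge_Inl[OF assms] by auto
  show ?thesis by (rule finite_subset[OF _ finite_R_at[OF u(1)]]) (use u(2) in auto)
qed

lemma Inl_coboundary_subset:
  assumes "c \<subseteq> verts \<Delta>"
  shows "(`) Inl ` coboundary \<Gamma> (Inl -` c) \<subseteq> coboundary \<Delta> c"
proof
  fix e :: "('v + 'v set) set"
  assume "e \<in> (`) Inl ` coboundary \<Gamma> (Inl -` c)"
  then obtain u v where "e = {Inl u, Inl v}" "{u, v} \<in> edges \<Gamma>" "Inl u \<in> c" "v \<in> verts \<Gamma>" "Inl v \<notin> c"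
    unfolding coboundary_def by auto
  then show "e \<in> coboundary \<Delta> c"
    using edge_coneI(1)[of u v] coboundary_pair[OF simple_cone assms, of "Inl u" "Inl v"] by simp
qed

text \<open>Ellipticity holds because each vertex of \<open>H\<close> on the side opposite to the
  cone vertex of \<open>H\<close> contributes its own boundary edge; only finitely many vertices of
  \<open>H\<close> can do so.\<close>

lemma cut_ground:
  assumes "cut \<Delta> c"
  shows "elliptic_cut \<Gamma> \<H> (Inl -` c)" "card (coboundary \<Gamma> (Inl -` c)) \<le> card (coboundary \<Delta> c)"
proof -
  let ?b = "Inl -` c"
  have c: "c \<subseteq> verts \<Delta>" and fin: "finite (coboundary \<Delta> c)" using assms by (auto simp: cut_def)
  have b: "?b \<subseteq> verts \<Gamma>" using c by (auto simp: verts_cone)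
  have inj: "inj_on ((`) (Inl :: _ \<Rightarrow> 'v + 'v set)) (coboundary \<Gamma> ?b)"
    by (intro inj_onI) (simp add: inj_image_eq_iff)
  have finb: "finite (coboundary \<Gamma> ?b)"
    using finite_subset[OF Inl_coboundary_subset[OF c] fin] inj by (rule finite_imageD)
  show "card (coboundary \<Gamma> ?b) \<le> card (coboundary \<Delta> c)"
    by (rule card_inj_on_le[OF inj Inl_coboundary_subset[OF c] fin])
  have "finite (?b \<inter> H) \<or> finite ((verts \<Gamma> - ?b) \<inter> H)" if H: "H \<in> \<H>" for H
  proof -
    let ?X = "{u \<in> H. Inl u \<in> c \<longleftrightarrow> Inr H \<notin> c}"
    have "(\<lambda>u. {Inl u, Inr H}) ` ?X \<subseteq> coboundary \<Delta> c"
      using edge_coneI(2)[OF H] coboundary_pair[OF simple_cone c] by auto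
    then have "finite ((\<lambda>u. {Inl u, Inr H}) ` ?X)" using fin by (rule finite_subset)
    then have "finite ?X" by (rule finite_imageD) (auto intro!: inj_onI simp: doubleton_eq_iff)
    moreover have "?b \<inter> H \<subseteq> ?X \<or> (verts \<Gamma> - ?b) \<inter> H \<subseteq> ?X" by auto
    ultimately show ?thesis using finite_subset by auto
  qed
  then show "elliptic_cut \<Gamma> \<H> ?b" using b finb by (simp add: elliptic_cut_def cut_def)
qed

text \<open>A split generator either contains a boundary edge of \<open>c\<close>, or has one edge
  wholly inside \<open>c\<close> and another wholly outside. In the second case two of its ground
  vertices lie on different sides at distance at most \<open>D\<close>, and a path between them
  crosses the ground boundary. So the generator meets the finite \<open>D\<close>-neighbourhood of
  that boundary.\<close>

lemma finite_R_split:
  assumes "cut \<Delta> c"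
  shows "finite {Z \<in> R. \<Union>Z \<inter> c \<noteq> {} \<and> \<Union>Z - c \<noteq> {}}"
proof -
  obtain D where D: "\<And>Z x y. Z \<in> R \<Longrightarrow> Inl x \<in> \<Union>Z \<Longrightarrow> Inl y \<in> \<Union>Z \<Longrightarrow> y \<in> graph_ball \<Gamma> D x"
    using R_diameterE by metis
  let ?b = "Inl -` c"
  have c: "c \<subseteq> verts \<Delta>" and fin: "finite (coboundary \<Delta> c)" using assms by (auto simp: cut_def)
  have b: "?b \<subseteq> verts \<Gamma>" and finb: "finite (coboundary \<Gamma> ?b)"
    using cut_ground(1)[OF assms] by (auto simp: elliptic_cut_def cut_def)
  define B where "B = \<Union>(coboundary \<Gamma> ?b)"
  have B: "finite B" "B \<subseteq> verts \<Gamma>"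
    unfolding B_def using cut_boundary_finite[OF simple_ground, of ?b] b finb by (auto simp: cut_def)
  define X where "X = (\<Union>z \<in> B. graph_ball \<Gamma> D z)"
  have X: "finite X" "X \<subseteq> verts \<Gamma>"
    unfolding X_def using graph_ball_Union[OF simple_ground locally_finite B] by simp_all
  let ?Y = "(\<Union>e \<in> coboundary \<Delta> c. {Z \<in> R. e \<in> Z}) \<union> (\<Union>x \<in> X. {Z \<in> R. Inl x \<in> \<Union>Z})"
  have fin': "finite ?Y"
    by (intro finite_UnI finite_UN_I fin X(1) finite_R_through finite_R_at subsetD[OF X(2)]
        subsetD[OF coboundary_subset_edges])
  have mem: "Z \<in> ?Y" if Z: "Z \<in> R" "\<Union>Z \<inter> c \<noteq> {}" "\<Union>Z - c \<noteq> {}" for Z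
  proof (cases "Z \<inter> coboundary \<Delta> c = {}")
    case True
    have ed: "e \<in> edges \<Delta>" if "e \<in> Z" for e using that R_finite_edges[OF Z(1)] by auto
    have side: "e \<subseteq> c \<or> e \<inter> c = {}" if "e \<in> Z" for e
      using True that ed[OF that] coboundary_iff[OF simple_cone c, of e] by auto
    obtain e f where ef: "e \<in> Z" "e \<inter> c \<noteq> {}" "f \<in> Z" "f - c \<noteq> {}" using Z(2,3) by auto
    obtain x where x: "Inl x \<in> e" using edge_Inl[OF ed[OF ef(1)]] by auto
    obtain y where y: "Inl y \<in> f" using edge_Inl[OF ed[OF ef(3)]] by auto
    have "x \<in> ?b" "y \<notin> ?b" using side[OF ef(1)] side[OF ef(3)] ef x y by auto
    moreover have "y \<in> graph_ball \<Gamma> D x" using D[OF Z(1) UnionI[OF ef(1) x] UnionI[OF ef(3) y]] .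
    ultimately obtain z where z: "z \<in> B" "z \<in> graph_ball \<Gamma> D x"
      unfolding B_def using graph_ball_crosses_coboundary[OF simple_ground b, of y D x] by auto
    then have "x \<in> X" unfolding X_def using graph_ball_sym[OF z(2)] by (intro UN_I)
    then show ?thesis using Z(1) UnionI[OF ef(1) x] by (intro UnI2 UN_I CollectI conjI)
  next
    case False
    then show ?thesis using Z(1) by auto
  qed
  show ?thesis by (rule finite_subset[OF _ fin'], rule subsetI, elim CollectE conjE, rule mem)
qed

theorem generated_cuts_cone: "generated_cuts \<Delta> R R\<^sub>0 (act ` carrier G)"
proof
  show "simple_graph \<Delta>" by (rule simple_cone)
  show "b = {} \<or> b = verts \<Delta>" if "b \<subseteq> verts \<Delta>" "coboundary \<Delta> b = {}" for b
    using connected_coboundary_empty[OF simple_cone connected_cone that] .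
  show "Z \<subseteq> edges \<Delta>" "finite Z" if "Z \<in> R" for Z using R_finite_edges[OF that] by auto
  show "even (card (Z \<inter> coboundary \<Delta> b))" if "Z \<in> R" "b \<subseteq> verts \<Delta>" for Z b
    using that cycle_space_support(3)[OF simple_cone] S_cycle_space by (auto simp: R_def)
  show "\<exists>b \<subseteq> verts \<Delta>. coboundary \<Delta> b = F"
    if "F \<subseteq> edges \<Delta>" "finite F" "\<And>Z. Z \<in> R \<Longrightarrow> even (card (Z \<inter> F))" for F
    using topological_generators_detect_coboundaries[OF simple_cone connected_cone generating_cone that(1,2)]
      that(3) by (auto simp: R_def)
  show "finite {Z \<in> R. e \<in> Z}" if "e \<in> edges \<Delta>" for e by (rule finite_R_through[OF that])
  show "finite {Z \<in> R. \<Union>Z \<inter> c \<noteq> {} \<and> \<Union>Z - c \<noteq> {}}" if "cut \<Delta> c" for c by (rule finite_R_split[OF that])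
  show "bij_betw g (verts \<Delta>) (verts \<Delta>)" if "g \<in> act ` carrier G" for g using that act_bij by auto
  show "g ` e \<in> edges \<Delta> \<longleftrightarrow> e \<in> edges \<Delta>" if "g \<in> act ` carrier G" "e \<subseteq> verts \<Delta>" for g e
    using that act_edge_iff by auto
  show "\<exists>h \<in> act ` carrier G. \<forall>v \<in> verts \<Delta>. h (g v) = v \<and> g (h v) = v" if g: "g \<in> act ` carrier G" for g
  proof -
    obtain x where x: "x \<in> carrier G" "g = act x" using g by auto
    then show ?thesis
      using act_inv[OF x(1)] group.inv_closed[OF group x(1)] by (intro bexI[of _ "act (inv\<^bsub>G\<^esub> x)"]) auto
  qed
  show "\<exists>g \<in> act ` carrier G. (`) g ` Z \<in> R\<^sub>0" if "Z \<in> R" for Z by (rule R_orbit_rep[OF that])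
  show "finite R\<^sub>0" unfolding R\<^sub>0_def using S_orbits by (intro finite_imageI)
  show "R\<^sub>0 \<subseteq> R" by (rule R0_subset)
qed

text \<open>Each cone vertex is placed so that only a finite set \<open>X H\<close> of vertices of
  \<open>H\<close> lies on the other side. The point is that \<open>X H\<close> is empty for all but
  finitely many \<open>H\<close>. If it is nonempty, some generator joins the cone vertex both to
  \<open>X H\<close> and to the rest of \<open>H\<close>; its bounded diameter forces
  \<open>H\<close> to come close to the boundary of \<open>b\<close>, and thinness leaves finitely
  many such \<open>H\<close>.\<close>

lemma elliptic_cut_extends:
  assumes "elliptic_cut \<Gamma> \<H> b"
  shows "\<exists>c. cut \<Delta> c \<and> Inl -` c = b"
proof -
  obtain D where D: "\<And>Z x y. Z \<in> R \<Longrightarrow> Inl x \<in> \<Union>Z \<Longrightarrow> Inl y \<in> \<Union>Z \<Longrightarrow> y \<in> graph_ball \<Gamma> D x"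
    using R_diameterE by metis
  have b: "b \<subseteq> verts \<Gamma>" and fin: "finite (coboundary \<Gamma> b)"
    and ell: "\<And>H. H \<in> \<H> \<Longrightarrow> finite (b \<inter> H) \<or> finite ((verts \<Gamma> - b) \<inter> H)"
    using assms by (auto simp: elliptic_cut_def cut_def)
  \<comment> \<open>The clause \<open>H \<inter> b \<noteq> {}\<close> decides the case of finite
    \<open>H\<close>, where both sides are finite: it makes \<open>X H\<close> a proper subset of
    \<open>H\<close>, which keeps the edges to \<open>X H\<close> from being the whole star of the
    cone vertex.\<close>
  define I where "I = {H \<in> \<H> - {{}}. H \<inter> b \<noteq> {} \<and> finite (H - b)}"
  define c where "c = Inl ` b \<union> Inr ` I"
  define X where "X H = (if H \<in> I then H - b else H \<inter> b)" for H
  have mem: "Inl u \<in> c \<longleftrightarrow> u \<in> b" "Inr H \<in> c \<longleftrightarrow> H \<in> I" for u H by (auto simp: c_def)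
  have c: "c \<subseteq> verts \<Delta>" using b by (auto simp: c_def verts_cone I_def)
  have finX: "finite (X H)" if "H \<in> \<H>" for H
  proof (cases "H \<in> I")
    case False
    have "(verts \<Gamma> - b) \<inter> H = H - b" using peripheral_verts[OF that] by auto
    then show ?thesis using False ell[OF that] that by (auto simp: X_def I_def Int_commute)
  qed (simp add: X_def I_def)
  have X_proper: "H - X H \<noteq> {}" if "H \<in> \<H>" "H \<noteq> {}" for H
  proof (cases "H \<in> I")
    case True
    then show ?thesis by (auto simp: X_def I_def)
  next
    case False
    then have "H \<inter> b = {} \<or> infinite (H - b)" using that by (auto simp: I_def)
    then have "H \<inter> b = {} \<or> H - b \<noteq> {}" by (metis finite.emptyI)
    then show ?thesis using False that(2) by (auto simp: X_def)
  qed
  define B where "B = \<Union>(coboundary \<Gamma> b)"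
  have B: "finite B" "B \<subseteq> verts \<Gamma>"
    unfolding B_def using cut_boundary_finite[OF simple_ground, of b] b fin by (auto simp: cut_def)
  define Y where "Y = (\<Union>z \<in> B. graph_ball \<Gamma> D z)"
  have Y: "finite Y" "Y \<subseteq> verts \<Gamma>"
    unfolding Y_def using graph_ball_Union[OF simple_ground locally_finite B] by simp_all
  define T where "T = {H \<in> \<H>. X H \<noteq> {}}"
  have near: "\<exists>u \<in> Y. u \<in> H" if H: "H \<in> \<H>" "X H \<noteq> {}" for H
  proof -
    define F where "F = (\<lambda>u. {Inl u, Inr H :: 'v + 'v set}) ` X H"
    have XH: "X H \<subseteq> H" by (auto simp: X_def)
    have Hne: "H \<noteq> {}" using H(2) XH by auto
    have F: "F \<subseteq> edges \<Delta>" "finite F" using edge_coneI(2)[OF H(1)] XH finX[OF H(1)] by (auto simp: F_def)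
    have memF: "{Inl u, Inr H} \<in> F \<longleftrightarrow> u \<in> X H" for u by (auto simp: F_def doubleton_eq_iff)
    \<comment> \<open>\<open>F\<close> is not a coboundary: it contains no ground edge, so by
      connectedness of \<Gamma> a set \<open>a\<close> with boundary \<open>F\<close> would contain
      all ground vertices or none, while \<open>F\<close> is a nonempty proper part of the star of
      the cone vertex.\<close>
    have "\<exists>Z \<in> R. odd (card (Z \<inter> F))"
    proof (rule ccontr)
      assume "\<not> ?thesis"
      then have "\<exists>a \<subseteq> verts \<Delta>. coboundary \<Delta> a = F"
        using topological_generators_detect_coboundaries[OF simple_cone connected_cone generating_cone F]
        by (auto simp: R_def)
      then obtain a where a: "a \<subseteq> verts \<Delta>" "coboundary \<Delta> a = F" by auto
      have "coboundary \<Gamma> (Inl -` a) = {}"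
      proof (rule ccontr)
        assume "coboundary \<Gamma> (Inl -` a) \<noteq> {}"
        then obtain e where "e \<in> coboundary \<Gamma> (Inl -` a)" by auto
        then have "Inl ` e \<in> F" using Inl_coboundary_subset[OF a(1)] a(2) by auto
        then show False by (auto simp: F_def)
      qed
      moreover have "Inl -` a \<subseteq> verts \<Gamma>" using a(1) by (auto simp: verts_cone)
      ultimately have side: "Inl -` a = {} \<or> Inl -` a = verts \<Gamma>"
        using connected_coboundary_empty[OF simple_ground connected] by auto
      obtain u w where uw: "u \<in> X H" "w \<in> H" "w \<notin> X H" using H(2) X_proper[OF H(1) Hne] by auto
      have "u \<in> verts \<Gamma>" "w \<in> verts \<Gamma>" using uw XH peripheral_verts[OF H(1)] by auto
      then have "Inl u \<in> a \<longleftrightarrow> Inl w \<in> a" using side by auto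
      moreover have "Inl u \<in> a \<longleftrightarrow> Inr H \<notin> a"
        using coboundary_pair[OF simple_cone a(1) edge_coneI(2)[OF H(1), of u]] uw XH memF a(2) by auto
      moreover have "Inl w \<in> a \<longleftrightarrow> Inr H \<in> a"
        using coboundary_pair[OF simple_cone a(1) edge_coneI(2)[OF H(1), of w]] uw memF a(2) by auto
      ultimately show False by auto
    qed
    then obtain Z where Z: "Z \<in> R" "odd (card (Z \<inter> F))" by auto
    \<comment> \<open>The full star is a coboundary, so \<open>Z\<close> meets it evenly although it
      meets \<open>F\<close> oddly. Hence \<open>Z\<close> contains an edge of \<open>F\<close> and
      a further edge of the star outside \<open>F\<close>, whose ground ends lie on different sides
      of \<open>b\<close>.\<close>
    let ?star = "coboundary \<Delta> {Inr H}"
    have sub: "{Inr H} \<subseteq> verts \<Delta>" using H(1) Hne by (auto simp: verts_cone)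
    have "F \<subseteq> ?star"
      using F(1) coboundary_pair[OF simple_cone sub] by (auto simp: F_def)
    moreover have "even (card (Z \<inter> ?star))"
      using Z(1) cycle_space_support(3)[OF simple_cone _ sub] S_cycle_space by (auto simp: R_def)
    then have "Z \<inter> F \<noteq> Z \<inter> ?star" using Z(2) by metis
    ultimately obtain e where e: "e \<in> Z" "e \<in> ?star" "e \<notin> F" by auto
    have eH: "Inr H \<in> e" and ed: "e \<in> edges \<Delta>" using e(2) coboundary_iff[OF simple_cone sub] by auto
    obtain w where w: "e = {Inl w, Inr H}" "w \<in> H"
      using ed by (cases rule: edges_coneE) (use eH in auto)
    have "Z \<inter> F \<noteq> {}" using Z(2) by auto
    then obtain u where u: "{Inl u, Inr H} \<in> Z" "u \<in> X H" by (auto simp: F_def)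
    have wX: "w \<notin> X H" using e(3) w memF by auto
    have "Inl u \<in> \<Union>Z" "Inl w \<in> \<Union>Z" using u(1) e(1) w(1) by auto
    then have "w \<in> graph_ball \<Gamma> D u" using D[OF Z(1)] by auto
    moreover have "(u \<in> b) \<noteq> (w \<in> b)" using u(2) wX w(2) by (auto simp: X_def split: if_splits)
    ultimately obtain z where z: "z \<in> B" "z \<in> graph_ball \<Gamma> D u"
      unfolding B_def using graph_ball_crosses_coboundary[OF simple_ground b, of w D u] by auto
    then have "u \<in> Y" unfolding Y_def using graph_ball_sym[OF z(2)] by (intro UN_I)
    then show ?thesis using u(2) XH by auto
  qed
  have "finite (\<Union>y \<in> Y. {H \<in> \<H>. y \<in> H})" using Y thin by (auto simp: thin_def)
  moreover have "T \<subseteq> (\<Union>y \<in> Y. {H \<in> \<H>. y \<in> H})"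
  proof
    fix H assume "H \<in> T"
    then show "H \<in> (\<Union>y \<in> Y. {H \<in> \<H>. y \<in> H})" using near[of H] by (auto simp: T_def)
  qed
  ultimately have finT: "finite T" by (rule finite_subset[rotated])
  let ?E = "(`) Inl ` coboundary \<Gamma> b \<union> (\<Union>H \<in> T. (\<lambda>u. {Inl u, Inr H :: 'v + 'v set}) ` X H)"
  have "coboundary \<Delta> c \<subseteq> ?E"
  proof
    fix e assume e: "e \<in> coboundary \<Delta> c"
    then have ed: "e \<in> edges \<Delta>" using coboundary_subset_edges by blast
    then show "e \<in> ?E"
    proof (cases rule: edges_coneE)
      case (1 u v)
      then have "{u, v} \<in> coboundary \<Gamma> b"
        using e ed coboundary_pair[OF simple_cone c, of "Inl u" "Inl v"] coboundary_pair[OF simple_ground b, of u v] mem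
        by simp
      moreover have "e = Inl ` {u, v}" using 1 by simp
      ultimately show ?thesis by (intro UnI1 image_eqI)
    next
      case (2 u H)
      then have "u \<in> b \<longleftrightarrow> H \<notin> I"
        using e ed coboundary_pair[OF simple_cone c, of "Inl u" "Inr H"] mem by simp
      then have "u \<in> X H" using 2 by (auto simp: X_def)
      then show ?thesis using 2 by (auto simp: T_def)
    qed
  qed
  moreover have "finite ?E" using fin finT finX by (auto simp: T_def)
  ultimately have "cut \<Delta> c" using c by (auto simp: cut_def intro: finite_subset)
  moreover have "Inl -` c = b" using mem by auto
  ultimately show ?thesis by blast
qed

end

section \<open>Ends as homomorphisms on cuts\<close>

lemma component_one_side:
  assumes "simple_graph \<Gamma>" "b \<subseteq> verts \<Gamma>" "\<Union>(coboundary \<Gamma> b) \<subseteq> K"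
    "C \<in> components_graph (delete_verts \<Gamma> K)"
  shows "C \<noteq> {}" "C \<subseteq> b \<or> C \<inter> b = {}"
proof -
  let ?r = "connection (delete_verts \<Gamma> K)"
  obtain x where x: "x \<in> verts (delete_verts \<Gamma> K)" "C = ?r `` {x}"
    using assms(4) by (auto simp: components_graph_def quotient_def)
  have "(x, x) \<in> ?r" using x(1) by (simp add: connection_def)
  then show "C \<noteq> {}" using x(2) by auto
  have "y \<in> b \<longleftrightarrow> x \<in> b" if "y \<in> C" for y
  proof -
    have "(x, y) \<in> {(x, y). {x, y} \<in> edges (delete_verts \<Gamma> K)}\<^sup>*"
      using that x(2) by (auto simp: connection_def)
    then show ?thesis
    proof (induction rule: rtrancl_induct)
      case (step y z)
      then have yz: "{y, z} \<in> edges \<Gamma>" "{y, z} \<inter> K = {}" by (auto simp: delete_verts_def)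
      then have "{y, z} \<notin> coboundary \<Gamma> b" using assms(3) by blast
      then show ?case using step.IH coboundary_pair[OF assms(1,2) yz(1)] by blast
    qed simp
  qed
  then show "C \<subseteq> b \<or> C \<inter> b = {}" by blast
qed

lemma end_component:
  assumes "\<omega> \<in> ends \<Gamma>" "finite K" "K \<subseteq> verts \<Gamma>"
  shows "\<omega> K \<in> components_graph (delete_verts \<Gamma> K)"
  using assms by (auto simp: ends_def PiE_iff)

lemma end_antimono:
  assumes "\<omega> \<in> ends \<Gamma>" "finite K'" "K' \<subseteq> verts \<Gamma>" "K \<subseteq> K'"
  shows "\<omega> K' \<subseteq> \<omega> K"
  using assms unfolding ends_def mem_Collect_eq by blast

text \<open>Passes from the subbasis to arbitrary open sets; intersections are handled by uniting
  the two finite sets, since ends are antitone in them.\<close>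

lemma end_neighbourhood:
  assumes "openin (end_compactification \<Gamma>) U" "\<omega> \<in> ends \<Gamma>" "Inr \<omega> \<in> U"
  shows "\<exists>K. finite K \<and> K \<subseteq> verts \<Gamma> \<and> Inl ` \<omega> K \<subseteq> U"
  using assms(1,3) unfolding end_compactification_def openin_topology_generated_by_iff
proof (induction rule: generate_topology_on.induct)
  case (Int U V)
  then obtain K L where K: "finite K" "K \<subseteq> verts \<Gamma>" "Inl ` \<omega> K \<subseteq> U"
    and L: "finite L" "L \<subseteq> verts \<Gamma>" "Inl ` \<omega> L \<subseteq> V" by auto
  have "\<omega> (K \<union> L) \<subseteq> \<omega> K" "\<omega> (K \<union> L) \<subseteq> \<omega> L"
    using K L by (intro end_antimono[OF assms(2)]; simp)+
  then show ?case using K L by (intro exI[of _ "K \<union> L"] conjI finite_UnI Un_least Int_greatest) blast+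
next
  case (UN \<U>)
  then obtain U where "U \<in> \<U>" "Inr \<omega> \<in> U" by auto
  then show ?case using UN.IH[of U] by (meson Union_upper subset_trans)
next
  case (Basis U)
  then obtain K C where "U = C <+> {\<omega> \<in> ends \<Gamma>. \<omega> K = C}" "finite K" "K \<subseteq> verts \<Gamma>" by auto
  then show ?case using Basis(2) by (intro exI[of _ K]) auto
qed simp

text \<open>Once all endpoints of boundary edges are deleted, a component lies on one side of
  \<open>b\<close>, so the component chosen by the end decides membership. \<open>K\<close> may be
  any larger finite set, which allows several cuts to be evaluated at a common one.\<close>

lemma limit_ends_iff:
  assumes "simple_graph \<Gamma>" "\<omega> \<in> ends \<Gamma>" "b \<subseteq> verts \<Gamma>" "finite K" "K \<subseteq> verts \<Gamma>" "\<Union>(coboundary \<Gamma> b) \<subseteq> K"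
  shows "\<omega> \<in> limit_ends \<Gamma> b \<longleftrightarrow> \<omega> K \<subseteq> b"
proof
  let ?N = "\<omega> K <+> {\<eta> \<in> ends \<Gamma>. \<eta> K = \<omega> K}"
  note comp = end_component[OF assms(2,4,5)]
  note side = component_one_side[OF assms(1,3,6) comp]
  have N: "openin (end_compactification \<Gamma>) ?N" "Inr \<omega> \<in> ?N"
    unfolding end_compactification_def openin_topology_generated_by_iff
    using comp assms(2,4,5) by (auto intro!: generate_topology_on.Basis)
  {
    assume "\<omega> \<in> limit_ends \<Gamma> b"
    then have "Inr \<omega> \<in> (end_compactification \<Gamma>) closure_of (Inl ` b)" by (simp add: limit_ends_def)
    then have "\<exists>y. y \<in> Inl ` b \<and> y \<in> ?N" using N unfolding in_closure_of by simp
    then obtain y where y: "y \<in> Inl ` b" "y \<in> ?N" by (elim exE conjE)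
    then show "\<omega> K \<subseteq> b" using side(2) by auto
  next
    assume sub: "\<omega> K \<subseteq> b"
    have "\<exists>v \<in> b. Inl v \<in> U" if U: "openin (end_compactification \<Gamma>) U" "Inr \<omega> \<in> U" for U
    proof -
      obtain L where L: "finite L" "L \<subseteq> verts \<Gamma>" "Inl ` \<omega> L \<subseteq> U"
        using end_neighbourhood[OF U(1) assms(2) U(2)] by auto
      have KL: "finite (K \<union> L)" "K \<union> L \<subseteq> verts \<Gamma>" using L assms(4,5) by auto
      have "\<omega> (K \<union> L) \<noteq> {}"
        using component_one_side(1)[OF assms(1,3) _ end_component[OF assms(2) KL]] assms(6) by auto
      moreover have "\<omega> (K \<union> L) \<subseteq> \<omega> K" "\<omega> (K \<union> L) \<subseteq> \<omega> L"
        by (rule end_antimono[OF assms(2) KL], simp)+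
      ultimately show ?thesis using sub L(3) by blast
    qed
    moreover have "Inr \<omega> \<in> topspace (end_compactification \<Gamma>)" by (rule subsetD[OF openin_subset[OF N(1)] N(2)])
    ultimately show "\<omega> \<in> limit_ends \<Gamma> b"
      using assms(2) unfolding limit_ends_def mem_Collect_eq in_closure_of by blast
  }
qed

lemma limit_ends_compl:
  assumes "simple_graph \<Gamma>" "\<omega> \<in> ends \<Gamma>" "cut \<Gamma> b"
  shows "\<omega> \<in> limit_ends \<Gamma> (verts \<Gamma> - b) \<longleftrightarrow> \<omega> \<notin> limit_ends \<Gamma> b"
proof -
  let ?K = "\<Union>(coboundary \<Gamma> b)"
  have b: "b \<subseteq> verts \<Gamma>" using assms(3) by (simp add: cut_def)
  note K = cut_boundary_finite[OF assms(1,3)]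
  have C: "\<omega> ?K \<in> components_graph (delete_verts \<Gamma> ?K)" using end_component[OF assms(2) K] .
  have "\<omega> ?K \<subseteq> verts \<Gamma>"
    using C by (auto simp: components_graph_def quotient_def connection_def delete_verts_def)
  then show ?thesis
    using limit_ends_iff[OF assms(1,2) b K subset_refl]
      limit_ends_iff[OF assms(1,2) Diff_subset K, of b] coboundary_compl[OF b]
      component_one_side[OF assms(1) b subset_refl C] by auto
qed

lemma limit_ends_Int:
  assumes "simple_graph \<Gamma>" "\<omega> \<in> ends \<Gamma>" "cut \<Gamma> a" "cut \<Gamma> b"
  shows "\<omega> \<in> limit_ends \<Gamma> (a \<inter> b) \<longleftrightarrow> \<omega> \<in> limit_ends \<Gamma> a \<and> \<omega> \<in> limit_ends \<Gamma> b"
proof -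
  let ?K = "\<Union>(coboundary \<Gamma> a) \<union> \<Union>(coboundary \<Gamma> b)"
  have ab: "a \<subseteq> verts \<Gamma>" "b \<subseteq> verts \<Gamma>" "a \<inter> b \<subseteq> verts \<Gamma>" using assms(3,4) by (auto simp: cut_def)
  have K: "finite ?K" "?K \<subseteq> verts \<Gamma>"
    using cut_boundary_finite[OF assms(1,3)] cut_boundary_finite[OF assms(1,4)] by auto
  have "\<Union>(coboundary \<Gamma> (a \<inter> b)) \<subseteq> ?K" using coboundary_Int_Un(1)[OF assms(1) ab(1,2)] by blast
  then show ?thesis
    using limit_ends_iff[OF assms(1,2) ab(1) K] limit_ends_iff[OF assms(1,2) ab(2) K]
      limit_ends_iff[OF assms(1,2) ab(3) K] by auto
qed

lemma separates_iff:
  assumes "simple_graph \<Gamma>" "\<omega> \<in> ends \<Gamma>" "\<eta> \<in> ends \<Gamma>" "cut \<Gamma> b"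
  shows "separates \<Gamma> b \<omega> \<eta> \<longleftrightarrow> (\<omega> \<in> limit_ends \<Gamma> b) \<noteq> (\<eta> \<in> limit_ends \<Gamma> b)"
  unfolding separates_def using limit_ends_compl[OF assms(1,2,4)] limit_ends_compl[OF assms(1,3,4)] by blast

context cone_generators
begin

text \<open>An end evaluates a cut of the cone-off through its trace on the ground vertices; the
  position of cone vertices does not affect the value.\<close>

lemma end_cut_hom:
  assumes "\<omega> \<in> ends \<Gamma>"
  shows "cut_hom \<Delta> (\<lambda>c. \<omega> \<in> limit_ends \<Gamma> (Inl -` c))"
  unfolding cut_hom_def
proof (intro conjI allI impI)
  have ground: "cut \<Gamma> (Inl -` c)" if "cut \<Delta> c" for c
    using cut_ground(1)[OF that] by (simp add: elliptic_cut_def)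
  show "\<omega> \<in> limit_ends \<Gamma> (Inl -` (a \<inter> b)) = (\<omega> \<in> limit_ends \<Gamma> (Inl -` a) \<and> \<omega> \<in> limit_ends \<Gamma> (Inl -` b))"
    if "cut \<Delta> a" "cut \<Delta> b" for a b
    using limit_ends_Int[OF simple_ground assms ground[OF that(1)] ground[OF that(2)]] by simp
  show "\<omega> \<in> limit_ends \<Gamma> (Inl -` (verts \<Delta> - a)) = (\<omega> \<notin> limit_ends \<Gamma> (Inl -` a))" if "cut \<Delta> a" for a
  proof -
    have "Inl -` (verts \<Delta> - a) = verts \<Gamma> - Inl -` a" by (auto simp: verts_cone)
    then show ?thesis using limit_ends_compl[OF simple_ground assms ground[OF that]] by simp
  qed
qed

theorem accessible: "accessible_relative \<Gamma> \<H>"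
proof -
  interpret generated_cuts \<Delta> R R\<^sub>0 "act ` carrier G" by (rule generated_cuts_cone)
  obtain k where k: "\<And>\<omega> \<eta> b. cut_hom \<Delta> \<omega> \<Longrightarrow> cut_hom \<Delta> \<eta> \<Longrightarrow> cut \<Delta> b \<Longrightarrow> \<omega> b \<noteq> \<eta> b \<Longrightarrow>
     \<exists>b. cut \<Delta> b \<and> \<omega> b \<noteq> \<eta> b \<and> card (coboundary \<Delta> b) \<le> k"
    using bounded_separation by metis
  \<comment> \<open>\<open>Suc k\<close> because relative accessibility asks for a bound of at least
    1.\<close>
  have "\<exists>b'. elliptic_cut \<Gamma> \<H> b' \<and> card (coboundary \<Gamma> b') \<le> Suc k \<and> separates \<Gamma> b' \<omega> \<eta>"
    if ends: "\<omega> \<in> ends \<Gamma>" "\<eta> \<in> ends \<Gamma>" and b: "elliptic_cut \<Gamma> \<H> b" "separates \<Gamma> b \<omega> \<eta>" for \<omega> \<eta> b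
  proof -
    note sep = separates_iff[OF simple_ground ends]
    obtain c where c: "cut \<Delta> c" "Inl -` c = b" using elliptic_cut_extends[OF b(1)] by auto
    have "cut \<Gamma> b" using b(1) by (simp add: elliptic_cut_def)
    then have "(\<omega> \<in> limit_ends \<Gamma> (Inl -` c)) \<noteq> (\<eta> \<in> limit_ends \<Gamma> (Inl -` c))" using b(2) sep c(2) by simp
    from k[OF end_cut_hom[OF ends(1)] end_cut_hom[OF ends(2)] c(1) this]
    obtain d where d: "cut \<Delta> d" "(\<omega> \<in> limit_ends \<Gamma> (Inl -` d)) \<noteq> (\<eta> \<in> limit_ends \<Gamma> (Inl -` d))"
      "card (coboundary \<Delta> d) \<le> k" by auto
    have e: "elliptic_cut \<Gamma> \<H> (Inl -` d)" "card (coboundary \<Gamma> (Inl -` d)) \<le> Suc k"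
      using cut_ground[OF d(1)] d(3) by auto
    then have "separates \<Gamma> (Inl -` d) \<omega> \<eta>" using sep d(2) by (simp add: elliptic_cut_def)
    then show ?thesis using e by blast
  qed
  then show ?thesis unfolding accessible_relative_def by (intro exI[of _ "Suc k"]) auto
qed

end

theorem theoremD:
  fixes G :: "('g, 'm) monoid_scheme"
    and \<Gamma> :: "'v ugraph"
    and \<phi> :: "'g \<Rightarrow> 'v \<Rightarrow> 'v"
    and \<H> :: "'v set set"
  assumes "group G"
    and "G_graph G \<Gamma> \<phi>"
    and "connected_graph \<Gamma>"
    and "locally_finite_graph \<Gamma>"
    and "quasi_transitive G \<Gamma> \<phi>"
    and "peripheral_system \<Gamma> \<H>"
    and "invariant_system G \<phi> \<H>"
    and "thin \<Gamma> \<H>"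
    and "topologically_finitely_generated G (cone_off \<Gamma> \<H>) (cone_action \<Gamma> \<H> \<phi>)"
  shows "accessible_relative \<Gamma> \<H>"
proof -
  obtain S where S: "topological_generating_set (cone_off \<Gamma> \<H>) S"
    "\<forall>g \<in> carrier G. \<forall>f \<in> S. edge_action G (cone_off \<Gamma> \<H>) (cone_action \<Gamma> \<H> \<phi>) g f \<in> S"
    "finite (orbits G S (edge_action G (cone_off \<Gamma> \<H>) (cone_action \<Gamma> \<H> \<phi>)))"
    using assms(9) by (auto simp: topologically_finitely_generated_def)
  interpret cone_generators G \<Gamma> \<phi> \<H> S
    by (rule cone_generators.intro) (use assms S in auto)
  show ?thesis by (rule accessible)
qed

end
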